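(* Let $\Omega=D(0,1)\subset\mathbb{R}^2$ be the unit disc, with a radial magnetic field $B=B(r)$, $r=\|q\|$, that admits a locally Lipschitz extension to a neighbourhood of $\overline{\Omega}$. Consider a trajectory starting at time $0$ on $\partial\Omega$ with velocity $v_1\ne0$ and entering $\Omega$; this means that, with $v_r,v_\theta$ the radial and tangential components of $v_1$, either $v_r<0$, or $v_r=0$ and $\frac{B(1)}{v_\theta}<-1$. Let $\gamma$ be the (oriented) angle between the outward pointing normal at the starting point and $v_1$. Let $H_0=\frac12\|v_1\|^2$, $G(r)=\int_0^r\tau B(\tau)\,\mathrm{d}\tau$, let $p_\theta=v_\theta+G(1)$ be the conserved angular momentum of the trajectory, and let $V(r)=\frac{(p_\theta-G(r))^2}{2r^2}$. Assume that (i) either the equation $V(r)=H_0$ has a solution $r\in(0,1)$ and its solution closest to $1$, denoted by $r^*$, satisfies $V'(r^* )<0$; (ii) or $p_\theta=0$ and the equation $V(r)=H_0$ has no solution in $(0,1)$. Then the trajectory escapes from $\Omega$ in finite time, with some velocity $v_2$, and the scattering angle $\omega$, i.e. the oriented angle from $v_1$ to $v_2$, is given modulo $2\pi$ as follows: (i) either the trajectory does not pass through the origin, and $\omega=\alpha+\pi-2\gamma$, where $$\alpha=2\int_{r^*}^1\frac{p_\theta-G(r)}{r\sqrt{2H_0r^2-(p_\theta-G(r))^2}}\,\mathrm{d}r;$$ (ii) or the trajectory passes through the origin (in which case $p_\theta=0$), and $\omega=\alpha-2\gamma$, where $$\alpha=2\int_0^1\frac{-G(r)}{r\sqrt{2H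_0r^2-G(r)^2}}\,\mathrm{d}r.$$
   Context: **Dynamics.** The particle has unit charge and mass and moves according to Newton's equation $\ddot q=B(\|q\|)\,(\dot q_2,-\dot q_1)$, where $q=(q_1,q_2)$. In polar coordinates $q=r(\cos\theta,\sin\theta)$ the Hamiltonian is $\frac{p_r^2}{2}+\frac{(p_\theta-G(r))^2}{2r^2}$. The angular momentum $p_\theta=r^2\dot\theta+G(r)$ and the energy $H_0=\frac12\|\dot q\|^2$ are conserved, and $r$ evolves according to the reduced one-dimensional Hamiltonian $\frac{p_r^2}{2}+V(r)$. **Velocity components and angles.** Identifying $\mathbb{R}^2$ with $\mathbb{C}$, the velocity at a point of polar angle $\theta$ is $(v_r+iv_\theta)e^{i\theta}$, with $v_r=\dot r=p_r$ and $v_\theta=r\dot\theta=r^{-1}(p_\theta-G(r))$. In particular, $\gamma=\arg(v_r+iv_\theta)$ for the initial velocity $v_1$. **Escape.** The trajectory "escapes from $\Omega$ in finite time with velocity $v_2$" means that, after entering $\Omega$, there is a first time $t>0$ at which it is again on $\partial\Omega$, and $v_2$ is its velocity at that time (so $\|v_2\|=\|v_1\|$). *)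

theory Defs
  imports "HOL-Analysis.Analysis" "HOL-Library.Real_Mod"
begin

text \<open>The plane is identified with \<^typ>\<open>complex\<close>. A radial field on the unit disc is given by its
  profile \<open>B\<close>, of which only the values on \<open>[0,1]\<close> matter. The extension is required to agree with
  the profile on the closed disc, so that \<open>B 1\<close> is the continuous boundary value of the field.\<close>

definition extends_locally_lipschitz :: "(real \<Rightarrow> real) \<Rightarrow> bool" where
  "extends_locally_lipschitz B \<longleftrightarrow>
    (\<exists>U (F :: complex \<Rightarrow> real). open U \<and> cball 0 1 \<subseteq> U
       \<and> local_lipschitz (UNIV :: real set) U (\<lambda>_. F)
       \<and> (\<forall>x\<in>cball 0 1. F x = B (norm x)))"

text \<open>Newton's equation, for a motion that stays in the closed unit disc during the time set \<open>J\<close>,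
  with one-sided derivatives at end points of \<open>J\<close>. The velocity \<open>q'\<close> is carried along with the
  position \<open>q\<close> so that it is also determined when \<open>J\<close> is a single point.\<close>

definition newton_on :: "(real \<Rightarrow> real) \<Rightarrow> real set \<Rightarrow> (real \<Rightarrow> complex) \<Rightarrow> (real \<Rightarrow> complex) \<Rightarrow> bool"
where
  "newton_on B J q q' \<longleftrightarrow>
    (\<forall>t\<in>J. q t \<in> cball 0 1
       \<and> (q has_vector_derivative q' t) (at t within J)
       \<and> (q' has_vector_derivative B (norm (q t)) *\<^sub>R Complex (Im (q' t)) (- Re (q' t)))
           (at t within J))"

text \<open>A trajectory starts at time \<open>0\<close> and is continued as long as it can be within the closed disc.
  Maximality excludes a premature end of the time interval \<open>J\<close>.\<close>

definition trajectory :: "(real \<Rightarrow> real) \<Rightarrow> real set \<Rightarrow> (real \<Rightarrow> complex) \<Rightarrow> (real \<Rightarrow> complex) \<Rightarrow> bool"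
where
  "trajectory B J q q' \<longleftrightarrow>
    is_interval J \<and> 0 \<in> J \<and> J \<subseteq> {0..} \<and> newton_on B J q q' \<and>
    (\<forall>J' p p'. is_interval J' \<and> J \<subseteq> J' \<and> J' \<subseteq> {0..} \<and> newton_on B J' p p'
         \<and> (\<forall>t\<in>J. p t = q t \<and> p' t = q' t) \<longrightarrow> J' = J)"

definition escapes_at ::
  "real set \<Rightarrow> (real \<Rightarrow> complex) \<Rightarrow> (real \<Rightarrow> complex) \<Rightarrow> real \<Rightarrow> complex \<Rightarrow> bool"
where
  "escapes_at J q q' T v \<longleftrightarrow>
    T \<in> J \<and> 0 < T \<and> (\<forall>t\<in>{0<..<T}. q t \<in> ball 0 1) \<and> q T \<in> sphere 0 1 \<and> v = q' T"

text \<open>A representative modulo \<open>2\<pi>\<close> of the angle from \<open>a\<close> to \<open>b\<close>, for nonzero \<open>a\<close> and \<open>b\<close>.\<close>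

definition oriented_angle :: "complex \<Rightarrow> complex \<Rightarrow> real" where
  "oriented_angle a b = Arg (b / a)"

definition flux :: "(real \<Rightarrow> real) \<Rightarrow> real \<Rightarrow> real" where
  "flux B r = integral {0..r} (\<lambda>\<tau>. \<tau> * B \<tau>)"

definition eff_potential :: "(real \<Rightarrow> real) \<Rightarrow> real \<Rightarrow> real \<Rightarrow> real" where
  "eff_potential B p r = (p - flux B r)\<^sup>2 / (2 * r\<^sup>2)"

definition deflection_integrand :: "(real \<Rightarrow> real) \<Rightarrow> real \<Rightarrow> real \<Rightarrow> real \<Rightarrow> real" where
  "deflection_integrand B p E r =
    (p - flux B r) / (r * sqrt (2 * E * r\<^sup>2 - (p - flux B r)\<^sup>2))"

end

theory Submission
  imports Defs
begin

text \<open>The squared radius \<open>\<rho>\<close> of a trajectory with energy \<open>E\<close> and angular momentum \<open>p\<close> satisfies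
  \<open>\<rho>'\<^sup>2 = 4 W(\<rho>)\<close> and \<open>\<rho>'' = 2 W'(\<rho>)\<close> with \<open>W(\<rho>) = 2 E \<rho> - (p - G)\<^sup>2\<close>, where the flux \<open>G\<close> is
  a function of \<open>\<rho>\<close>. This equation is regular at the origin, and in both cases of the theorem the
  largest zero of \<open>W\<close> in \<open>[0,1)\<close> (\<open>r\<^sup>*\<close> squared, or \<open>0\<close>) is simple, so it is reached at a finite
  time \<open>t0\<close>. Reversing time and reflecting in a line maps solutions to solutions, since \<open>B\<close> is
  radial; uniqueness then makes the trajectory symmetric about \<open>t0\<close>. It therefore leaves the disc
  at time \<open>2 t0\<close>, with velocity a reflection of \<open>v1\<close>, and the axis of the reflection is obtained
  by integrating the angular velocity \<open>(p - G) / \<rho>\<close> over \<open>[0,t0]\<close> with the radius as variable.\<close>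

section \<open>Bounded Lipschitz differential equations\<close>

lemma integral_has_vector_derivative_atLeast:
  fixes h :: "real \<Rightarrow> 'a::banach"
  assumes "continuous_on {a..} h" "a \<le> t"
  shows "((\<lambda>u. integral {a..u} h) has_vector_derivative h t) (at t within {a..})"
proof -
  have "continuous_on {a..t+1} h"
    using assms(1) by (rule continuous_on_subset) auto
  then have "((\<lambda>u. integral {a..u} h) has_vector_derivative h t) (at t within {a..t+1})"
    using assms(2) by (intro integral_has_vector_derivative) auto
  moreover have "at t within {a..t+1} = at t within {a..}"
    by (rule at_within_nhd[where S = "{..<t+1}"]) auto
  ultimately show ?thesis by simp
qed

text \<open>Banach's fixed point theorem on the whole half line: the weight \<open>exp (- K t)\<close> makes the
  Picard operator a contraction, and boundedness of \<open>f\<close> keeps weighted solutions bounded.\<close>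

lemma lipschitz_bounded_ode_forward:
  fixes f :: "'a::banach \<Rightarrow> 'a"
  assumes lip: "L-lipschitz_on UNIV f" and bound: "\<And>x. norm (f x) \<le> M"
  obtains x where "x 0 = x0" "\<And>t. 0 \<le> t \<Longrightarrow> (x has_vector_derivative f (x t)) (at t within {0..})"
proof -
  \<comment> \<open>Any rate of at least \<open>2 * L\<close> brings the contraction factor
    \<open>L / K\<close> down to 1/2; the summand 1 keeps the rate positive when
    \<open>L = 0\<close>.\<close>
  define K where "K = 2 * L + 1"
  have L0: "0 \<le> L" using lip by (rule lipschitz_on_nonneg)
  then have K0: "0 < K" by (simp add: K_def)
  have M0: "0 \<le> M" using bound[of undefined] norm_ge_zero order_trans by blast
  have contf: "continuous_on UNIV f" using lip by (rule lipschitz_on_continuous_on)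
  \<comment> \<open>The unknown \<open>y\<close> is the solution multiplied by the weight
    \<open>exp (- (K * s))\<close>; the weight is undone before \<open>f\<close> is applied.\<close>
  define h where "h y s = f (exp (K * s) *\<^sub>R apply_bcontfun y s)" for y :: "real \<Rightarrow>\<^sub>C 'a" and s
  have conth: "continuous_on S (h y)" for y S
    unfolding h_def
    by (rule continuous_on_compose2[OF contf]) (auto intro!: continuous_intros)
  have inth: "h y integrable_on {a..b}" for y a b
    using conth by (rule integrable_continuous_real)
  define P where "P y t = x0 + integral {0..t} (h y)" for y t
  have derP: "(P y has_vector_derivative h y t) (at t within {0..})" if "0 \<le> t" for y t
    unfolding P_def
    by (rule derivative_eq_intros integral_has_vector_derivative_atLeast conth that refl)+ simp
  have contP: "continuous_on {0..} (P y)" for y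
    by (rule continuous_on_vector_derivative) (use derP in auto)
  \<comment> \<open>Bounded continuous functions are taken on the whole line here, so the weighted
    Picard operator is continued to negative times by its constant value at 0.\<close>
  define A where "A y t = exp (- (K * max 0 t)) *\<^sub>R P y (max 0 t)" for y t
  have Abc: "A y \<in> bcontfun" for y
  proof (rule bcontfun_normI)
    show "continuous_on UNIV (A y)"
      unfolding A_def
      by (intro continuous_intros continuous_on_compose2[OF contP]) auto
  next
    fix t :: real
    define u where "u = max 0 t"
    have u0: "0 \<le> u" by (simp add: u_def)
    have "norm (integral {0..u} (h y)) \<le> M * (u - 0)"
      by (rule integral_bound[OF u0 conth]) (simp add: h_def bound)
    then have "norm (P y u) \<le> norm x0 + M * u"
      unfolding P_def using norm_triangle_ineq[of x0 "integral {0..u} (h y)"] by simp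
    then have "norm (A y t) \<le> exp (- (K * u)) * (norm x0 + M * u)"
      unfolding A_def u_def by (simp add: mult_left_mono)
    also have "\<dots> \<le> norm x0 + M / K"
    proof -
      have "exp (- (K * u)) * norm x0 \<le> 1 * norm x0"
        using K0 u0 by (intro mult_right_mono) auto
      moreover have "exp (- (K * u)) * (M * u) \<le> M / K"
      proof -
        have "K * u \<le> exp (K * u)" using exp_ge_add_one_self[of "K * u"] by linarith
        then have "exp (- (K * u)) * (K * u) \<le> 1"
          by (simp add: exp_minus field_simps)
        then have "exp (- (K * u)) * (K * u) * (M / K) \<le> 1 * (M / K)"
          using K0 M0 by (intro mult_right_mono) auto
        then show ?thesis using K0 by (simp add: field_simps)
      qed
      ultimately show ?thesis by (simp add: distrib_left)
    qed
    finally show "norm (A y t) \<le> norm x0 + M / K" .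
  qed
  define T where "T y = Bcontfun (A y)" for y
  have T: "apply_bcontfun (T y) = A y" for y
    unfolding T_def using Abc by (rule Bcontfun_inverse)
  have "dist (T y) (T z) \<le> 1/2 * dist y z" for y z
  proof (rule dist_bound)
    fix t :: real
    define u where "u = max 0 t"
    have u0: "0 \<le> u" by (simp add: u_def)
    have est: "norm (h y s - h z s) \<le> L * dist y z * exp (K * s)" for s
    proof -
      have "norm (h y s - h z s) \<le> L * dist (exp (K * s) *\<^sub>R apply_bcontfun y s)
          (exp (K * s) *\<^sub>R apply_bcontfun z s)"
        unfolding h_def dist_norm[symmetric] using lip by (auto dest: lipschitz_onD)
      also have "\<dots> = L * (exp (K * s) * dist (apply_bcontfun y s) (apply_bcontfun z s))"
        by (simp add: dist_norm scaleR_diff_right[symmetric])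
      also have "\<dots> \<le> L * (exp (K * s) * dist y z)"
        using L0 by (intro mult_left_mono dist_bounded) auto
      finally show ?thesis by (simp add: mult_ac)
    qed
    have int: "((\<lambda>s. L * dist y z * exp (K * s)) has_integral
        L * dist y z / K * exp (K * u) - L * dist y z / K * exp (K * 0)) {0..u}"
      by (rule fundamental_theorem_of_calculus[OF u0])
        (use K0 in \<open>auto intro!: derivative_eq_intros
            simp: has_real_derivative_iff_has_vector_derivative[symmetric]\<close>)
    have "norm (P y u - P z u) = norm (integral {0..u} (\<lambda>s. h y s - h z s))"
      by (simp add: P_def integral_diff inth)
    also have "\<dots> \<le> integral {0..u} (\<lambda>s. L * dist y z * exp (K * s))"
      by (rule integral_norm_bound_integral)
        (use int est inth in \<open>auto intro!: integrable_diff\<close>)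
    also have "\<dots> = L * dist y z / K * exp (K * u) - L * dist y z / K"
      using integral_unique[OF int] by simp
    also have "\<dots> \<le> L * dist y z / K * exp (K * u)"
      using L0 K0 by simp
    also have "\<dots> \<le> 1/2 * dist y z * exp (K * u)"
    proof -
      have "L / K \<le> 1/2" using L0 by (simp add: K_def field_simps)
      then have "L / K * (dist y z * exp (K * u)) \<le> 1/2 * (dist y z * exp (K * u))"
        by (intro mult_right_mono) auto
      then show ?thesis by simp
    qed
    finally have "exp (- (K * u)) * norm (P y u - P z u)
        \<le> exp (- (K * u)) * (1/2 * dist y z * exp (K * u))"
      by (intro mult_left_mono) auto
    also have "\<dots> = 1/2 * dist y z"
      by (simp add: exp_minus field_simps)
    finally show "dist (apply_bcontfun (T y) t) (apply_bcontfun (T z) t) \<le> 1/2 * dist y z"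
      unfolding T A_def u_def[symmetric] dist_norm scaleR_diff_right[symmetric] by simp
  qed
  then obtain y where y: "T y = y"
    using banach_fix_type[of "1/2" T] by auto
  have yP: "exp (K * t) *\<^sub>R apply_bcontfun y t = P y t" if "0 \<le> t" for t
  proof -
    have "apply_bcontfun y t = A y t" using T[of y] y by simp
    then show ?thesis using that by (simp add: A_def exp_minus)
  qed
  show ?thesis
  proof (rule that[of "P y"])
    show "P y 0 = x0" by (simp add: P_def)
    show "(P y has_vector_derivative f (P y t)) (at t within {0..})" if "0 \<le> t" for t
      using derP[OF that, of y] yP[OF that] by (simp add: h_def)
  qed
qed

text \<open>Negative times are covered by a forward solution for \<open>- f\<close> run backwards.
  At 0 both halves have the one-sided derivative \<open>f x0\<close>, so they join
  differentiably.\<close>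

lemma lipschitz_bounded_ode:
  fixes f :: "'a::banach \<Rightarrow> 'a"
  assumes lip: "L-lipschitz_on UNIV f" and bound: "\<And>x. norm (f x) \<le> M"
  obtains x where "x 0 = x0" "\<And>t. (x has_vector_derivative f (x t)) (at t)"
proof -
  obtain y where y: "y 0 = x0"
    "\<And>t. 0 \<le> t \<Longrightarrow> (y has_vector_derivative f (y t)) (at t within {0..})"
    using lipschitz_bounded_ode_forward[OF lip bound] by metis
  have lip': "L-lipschitz_on UNIV (\<lambda>x. - f x)"
    using lip by (simp add: lipschitz_on_minus)
  obtain z where z: "z 0 = x0"
    "\<And>t. 0 \<le> t \<Longrightarrow> (z has_vector_derivative - f (z t)) (at t within {0..})"
    using lipschitz_bounded_ode_forward[OF lip', of M] bound by (metis norm_minus_cancel)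
  have z': "((\<lambda>t. z (- t)) has_vector_derivative f (z (- t))) (at t within {..0})" if "t \<le> 0" for t
  proof -
    have "(z \<circ> uminus has_vector_derivative (-1) *\<^sub>R (- f (z (- t)))) (at t within {..0})"
    proof (rule vector_diff_chain_within)
      show "(uminus has_vector_derivative - 1) (at t within {..0})"
        by (auto intro!: derivative_eq_intros)
      have "uminus ` {..0::real} = {0..}" by (force simp: image_iff intro: bexI[of _ "- x" for x])
      then show "(z has_vector_derivative - f (z (- t))) (at (- t) within uminus ` {..0})"
        using z(2)[of "- t"] that by simp
    qed
    then show ?thesis by (simp add: o_def)
  qed
  define x where "x t = (if t \<in> {0..} then y t else z (- t))" for t
  show ?thesis
  proof (rule that[of x])
    show "x 0 = x0" by (simp add: x_def y)
    show "(x has_vector_derivative f (x t)) (at t)" for t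
    proof -
      have "((\<lambda>t. if t \<in> {0..} then y t else z (- t)) has_vector_derivative
          (if t \<in> {0..} then f (y t) else f (z (- t)))) (at t within UNIV)"
      proof (rule has_vector_derivative_If_within_closures[where f' = "\<lambda>t. f (y t)" and g' = "\<lambda>t. f (z (- t))"])
        show "(y has_vector_derivative f (y t)) (at t within {0..} \<union> closure {0..} \<inter> closure {..0})"
          if "t \<in> {0..} \<union> closure {0..} \<inter> closure {..0}"
        proof -
          have *: "{0..} \<union> closure {0..} \<inter> closure {..0} = {0::real..}" by auto
          show ?thesis using that y(2)[of t] unfolding * by auto
        qed
        show "((\<lambda>t. z (- t)) has_vector_derivative f (z (- t)))
            (at t within {..0} \<union> closure {0..} \<inter> closure {..0})"
          if "t \<in> {..0} \<union> closure {0..} \<inter> closure {..0}"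
        proof -
          have *: "{..0} \<union> closure {0..} \<inter> closure {..0} = {..0::real}" by auto
          show ?thesis using that z'[of t] unfolding * by auto
        qed
      qed (use y(1) z(1) in auto)
      then show ?thesis unfolding x_def by (simp cong: if_cong add: if_distrib[of f])
    qed
  qed
qed

text \<open>The chord has length \<open>2 * \<bar>sin ((a - b) / 2)\<bar>\<close>, and the sine is
  bounded by its argument. This is the Lipschitz estimate for a velocity that is parametrised by its
  angle.\<close>

lemma dist_cis_le: "dist (cis a) (cis b) \<le> dist a b"
proof -
  have "(dist (cis a) (cis b))\<^sup>2 = (cos a - cos b)\<^sup>2 + (sin a - sin b)\<^sup>2"
    by (simp add: dist_norm cmod_power2)
  also have "\<dots> = (2 * sin ((a - b) / 2))\<^sup>2"
  proof -
    have "cos (a - b) = 1 - 2 * (sin ((a - b) / 2))\<^sup>2"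
      using cos_double_sin[of "(a - b) / 2"] by (simp only: mult_2 field_sum_of_halves)
    moreover have "(cos a - cos b)\<^sup>2 + (sin a - sin b)\<^sup>2 = 2 - 2 * cos (a - b)"
      using sin_cos_squared_add[of a] sin_cos_squared_add[of b]
      by (simp add: cos_diff power2_eq_square algebra_simps)
    ultimately show ?thesis by (simp add: power2_eq_square)
  qed
  also have "\<dots> \<le> (dist a b)\<^sup>2"
    using abs_sin_x_le_abs_x[of "(a - b) / 2"]
    by (intro power2_le_iff_abs_le[THEN iffD2]) (auto simp: dist_real_def abs_mult)
  finally show ?thesis by (rule power2_le_imp_le) simp
qed

section \<open>Existence and uniqueness for Newton's equation\<close>

text \<open>Multiplication by \<open>exp (- (C * t))\<close> turns \<open>D\<close> into a
  nonincreasing function, which starts at 0 and cannot become negative.\<close>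

lemma gronwall_zero:
  fixes D D' :: "real \<Rightarrow> real"
  assumes der: "\<And>t. t \<in> {0..s} \<Longrightarrow> (D has_vector_derivative D' t) (at t within {0..s})"
    and le: "\<And>t. t \<in> {0..s} \<Longrightarrow> D' t \<le> C * D t"
    and D0: "D 0 = 0" and nonneg: "\<And>t. t \<in> {0..s} \<Longrightarrow> 0 \<le> D t"
    and t: "t \<in> {0..s}"
  shows "D t = 0"
proof -
  define E where "E t = exp (- (C * t)) * D t" for t
  have "continuous_on {0..s} D"
    by (rule continuous_on_vector_derivative) (rule der)
  then have contD: "continuous_on {0..t} D"
    by (rule continuous_on_subset) (use t in auto)
  have contE: "continuous_on {0..t} E"
    unfolding E_def by (intro continuous_intros contD)
  have "E t \<le> E 0"
  proof (rule DERIV_nonpos_imp_decreasing_open[of 0 t E])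
    show "0 \<le> t" using t by simp
    show "\<exists>y. DERIV E u :> y \<and> y \<le> 0" if u: "0 < u" "u < t" for u
    proof (intro exI conjI)
      have "at u within {0..s} = at u" using u t by (intro at_within_interior) auto
      then have "DERIV D u :> D' u"
        using der[of u] u t by (simp add: has_real_derivative_iff_has_vector_derivative)
      then show "DERIV E u :> exp (- (C * u)) * (D' u - C * D u)"
        unfolding E_def by (auto intro!: derivative_eq_intros simp: algebra_simps)
      show "exp (- (C * u)) * (D' u - C * D u) \<le> 0"
        using le[of u] u t by (intro mult_nonneg_nonpos) auto
    qed
  qed (rule contE)
  then have "D t \<le> 0" by (simp add: E_def D0 mult_le_0_iff)
  with nonneg[OF t] show ?thesis by simp
qed

text \<open>Gronwall's argument for the squared distance in phase space. The force is a product of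
  \<open>b\<close> and the velocity, hence not globally Lipschitz; a speed bound for one of the two
  solutions makes up for this.\<close>

lemma newton_unique:
  fixes b :: "complex \<Rightarrow> real" and q p :: "real \<Rightarrow> complex"
  assumes lip: "K-lipschitz_on UNIV b"
    and q: "\<And>t. t \<in> {0..s} \<Longrightarrow> (q has_vector_derivative q' t) (at t within {0..s})"
      "\<And>t. t \<in> {0..s} \<Longrightarrow> (q' has_vector_derivative b (q t) *\<^sub>R (- \<i> * q' t)) (at t within {0..s})"
    and p: "\<And>t. t \<in> {0..s} \<Longrightarrow> (p has_vector_derivative p' t) (at t within {0..s})"
      "\<And>t. t \<in> {0..s} \<Longrightarrow> (p' has_vector_derivative b (p t) *\<^sub>R (- \<i> * p' t)) (at t within {0..s})"
    and speed: "\<And>t. t \<in> {0..s} \<Longrightarrow> norm (p' t) \<le> R"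
    and init: "q 0 = p 0" "q' 0 = p' 0"
    and t: "t \<in> {0..s}"
  shows "q t = p t" "q' t = p' t"
proof -
  define x y where "x t = q t - p t" and "y t = q' t - p' t" for t
  define y' where "y' t = b (q t) *\<^sub>R (- \<i> * q' t) - b (p t) *\<^sub>R (- \<i> * p' t)" for t
  have dx: "(x has_vector_derivative y t) (at t within {0..s})" if "t \<in> {0..s}" for t
    unfolding x_def y_def using that by (intro has_vector_derivative_diff q p)
  have dy: "(y has_vector_derivative y' t) (at t within {0..s})" if "t \<in> {0..s}" for t
    unfolding y_def y'_def using that by (intro has_vector_derivative_diff q p)
  have "x t \<bullet> x t + y t \<bullet> y t = 0"
  proof (rule gronwall_zero[where C = "1 + K * R" and s = s and t = t
        and D = "\<lambda>t. x t \<bullet> x t + y t \<bullet> y t"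
        and D' = "\<lambda>t. (x t \<bullet> y t + y t \<bullet> x t) + (y t \<bullet> y' t + y' t \<bullet> y t)"])
    fix t assume t: "t \<in> {0..s}"
    show "((\<lambda>t. x t \<bullet> x t + y t \<bullet> y t) has_vector_derivative
        (x t \<bullet> y t + y t \<bullet> x t) + (y t \<bullet> y' t + y' t \<bullet> y t)) (at t within {0..s})"
      by (intro has_vector_derivative_add bounded_bilinear.has_vector_derivative[OF bounded_bilinear_inner]
          dx dy t)
    \<comment> \<open>Multiplication by \<open>- \<i>\<close> is a quarter turn, so the part of
      \<open>y' t\<close> that contains \<open>b (q t)\<close> times the difference of the
      velocities is orthogonal to \<open>y t\<close> and drops out.\<close>
    have y': "y t \<bullet> y' t = (b (q t) - b (p t)) * (y t \<bullet> (- \<i> * p' t))"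
      by (simp add: y'_def y_def inner_complex_def algebra_simps)
    have K0: "0 \<le> K" using lip by (rule lipschitz_on_nonneg)
    have "\<bar>b (q t) - b (p t)\<bar> \<le> K * norm (x t)"
      using lip by (auto dest!: lipschitz_onD simp: x_def dist_norm dist_real_def)
    moreover have "\<bar>y t \<bullet> (- \<i> * p' t)\<bar> \<le> norm (y t) * R"
      using Cauchy_Schwarz_ineq2[of "y t" "- \<i> * p' t"]
        mult_left_mono[OF speed[OF t], of "norm (y t)"] by (simp add: norm_mult)
    ultimately have "\<bar>y t \<bullet> y' t\<bar> \<le> (K * norm (x t)) * (norm (y t) * R)"
      unfolding y' abs_mult using K0 by (intro mult_mono) auto
    then have 1: "y t \<bullet> y' t \<le> (K * R) * (norm (x t) * norm (y t))" by (simp add: mult_ac)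
    have 2: "x t \<bullet> y t \<le> norm (x t) * norm (y t)" by (rule norm_cauchy_schwarz)
    have R0: "0 \<le> R" using speed[OF t] norm_ge_zero order_trans by blast
    have 3: "2 * (norm (x t) * norm (y t)) \<le> x t \<bullet> x t + y t \<bullet> y t"
      using sum_squares_bound[of "norm (x t)" "norm (y t)"]
      by (simp add: power2_norm_eq_inner)
    have "x t \<bullet> y t + y t \<bullet> x t + (y t \<bullet> y' t + y' t \<bullet> y t) = 2 * (x t \<bullet> y t) + 2 * (y t \<bullet> y' t)"
      by (simp add: inner_commute)
    also have "\<dots> \<le> 2 * (norm (x t) * norm (y t)) + 2 * ((K * R) * (norm (x t) * norm (y t)))"
      using 1 2 by linarith
    also have "\<dots> = (1 + K * R) * (2 * (norm (x t) * norm (y t)))"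
      by (simp add: algebra_simps)
    also have "\<dots> \<le> (1 + K * R) * (x t \<bullet> x t + y t \<bullet> y t)"
      using 3 K0 R0 by (intro mult_left_mono) auto
    finally show "x t \<bullet> y t + y t \<bullet> x t + (y t \<bullet> y' t + y' t \<bullet> y t)
        \<le> (1 + K * R) * (x t \<bullet> x t + y t \<bullet> y t)" .
  qed (use t init in \<open>auto simp: x_def y_def\<close>)
  moreover have "0 \<le> x t \<bullet> x t" "0 \<le> y t \<bullet> y t" by simp_all
  ultimately have "x t \<bullet> x t = 0" "y t \<bullet> y t = 0" by linarith+
  then show "q t = p t" "q' t = p' t" by (simp_all add: x_def y_def)
qed

text \<open>With the velocity written as \<open>v0 * cis (- \<beta>)\<close> the equation becomes a bounded and globally
  Lipschitz system for the pair \<open>(q, \<beta>)\<close>.\<close>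

lemma newton_flow:
  fixes b :: "complex \<Rightarrow> real"
  assumes lip: "K-lipschitz_on UNIV b" and bound: "\<And>z. \<bar>b z\<bar> \<le> M"
  obtains q v where "q 0 = q0" "v 0 = v0" "\<And>t. norm (v t) = norm v0"
    "\<And>t. (q has_vector_derivative v t) (at t)"
    "\<And>t. (v has_vector_derivative b (q t) *\<^sub>R (- \<i> * v t)) (at t)"
proof -
  define f :: "complex \<times> real \<Rightarrow> complex \<times> real"
    where "f x = (v0 * cis (- snd x), b (fst x))" for x
  have K0: "0 \<le> K" using lip by (rule lipschitz_on_nonneg)
  have norm_pair: "norm z \<le> norm (fst z) + norm (snd z)" for z :: "complex \<times> real"
    using sqrt_sum_squares_le_sum_abs[of "norm (fst z)" "norm (snd z)"] by (simp add: norm_prod_def)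
  have lipf: "(norm v0 + K)-lipschitz_on UNIV f"
  proof (rule lipschitz_onI)
    fix x y
    have "dist (f x) (f y) \<le> dist (v0 * cis (- snd x)) (v0 * cis (- snd y)) + dist (b (fst x)) (b (fst y))"
      using norm_pair[of "f x - f y"] by (simp add: dist_norm f_def)
    also have "\<dots> \<le> norm v0 * dist (snd x) (snd y) + K * dist (fst x) (fst y)"
    proof (rule add_mono)
      have "dist (v0 * cis (- snd x)) (v0 * cis (- snd y)) = norm v0 * dist (cis (- snd x)) (cis (- snd y))"
        by (simp add: dist_norm right_diff_distrib[symmetric] norm_mult)
      also have "\<dots> \<le> norm v0 * dist (snd x) (snd y)"
        using dist_cis_le[of "- snd x" "- snd y"] by (intro mult_left_mono) (auto simp: dist_minus)
      finally show "dist (v0 * cis (- snd x)) (v0 * cis (- snd y)) \<le> norm v0 * dist (snd x) (snd y)" .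
      show "dist (b (fst x)) (b (fst y)) \<le> K * dist (fst x) (fst y)"
        using lip by (auto dest: lipschitz_onD)
    qed
    also have "\<dots> \<le> norm v0 * dist x y + K * dist x y"
      using K0 by (intro add_mono mult_left_mono dist_fst_le dist_snd_le) auto
    finally show "dist (f x) (f y) \<le> (norm v0 + K) * dist x y" by (simp add: algebra_simps)
  qed (use K0 in auto)
  have boundf: "norm (f x) \<le> norm v0 + M" for x
    using norm_pair[of "f x"] bound[of "fst x"] by (simp add: f_def norm_mult)
  obtain x where x: "x 0 = (q0, 0)" "\<And>t. (x has_vector_derivative f (x t)) (at t)"
    using lipschitz_bounded_ode[OF lipf boundf, where ?x0.0 = "(q0, 0)"] by blast
  define q \<beta> where "q t = fst (x t)" and "\<beta> t = snd (x t)" for t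
  define v where "v t = v0 * cis (- \<beta> t)" for t
  have dq: "(q has_vector_derivative v t) (at t)" for t
    using bounded_linear.has_vector_derivative[OF bounded_linear_fst x(2)[of t]]
    by (simp add: q_def[abs_def] v_def \<beta>_def f_def)
  have d\<beta>: "(\<beta> has_vector_derivative b (q t)) (at t)" for t
    using bounded_linear.has_vector_derivative[OF bounded_linear_snd x(2)[of t]]
    by (simp add: q_def[abs_def] v_def \<beta>_def[abs_def] f_def)
  have "(v has_vector_derivative b (q t) *\<^sub>R (- \<i> * v t)) (at t)" for t
  proof -
    have "((\<lambda>t. cis (- \<beta> t)) has_vector_derivative - b (q t) *\<^sub>R (\<i> * cis (- \<beta> t))) (at t within UNIV)"
      using d\<beta>[of t] by (auto simp: has_vector_derivative_def intro!: derivative_eq_intros)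
    then have "((\<lambda>t. v0 * cis (- \<beta> t)) has_vector_derivative v0 * (- b (q t) *\<^sub>R (\<i> * cis (- \<beta> t)))) (at t)"
      by (rule has_vector_derivative_mult_right)
    then show ?thesis by (simp add: v_def[abs_def] scaleR_conv_of_real mult_ac)
  qed
  moreover have "q 0 = q0" "v 0 = v0" "norm (v t) = norm v0" for t
    by (simp_all add: q_def v_def \<beta>_def x norm_mult)
  ultimately show ?thesis using dq that by blast
qed

section \<open>Extension of the field from the disc to the whole plane\<close>

lemma extends_lipschitz_on:
  assumes "extends_locally_lipschitz B"
  obtains K where "K-lipschitz_on {0..1} B"
proof -
  obtain U and F :: "complex \<Rightarrow> real" where F: "open U" "cball 0 1 \<subseteq> U"
    "local_lipschitz (UNIV :: real set) U (\<lambda>_. F)" "\<And>x. x \<in> cball 0 1 \<Longrightarrow> F x = B (norm x)"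
    using assms unfolding extends_locally_lipschitz_def by blast
  \<comment> \<open>The field is autonomous, so a single instant serves as the compact time set; on
    the compact disc the local Lipschitz property is then global.\<close>
  have "local_lipschitz {0::real} (cball 0 1) (\<lambda>_. F)"
    using F(2) by (intro local_lipschitz_subset[OF F(3)]) auto
  then obtain L where L: "L-lipschitz_on (cball 0 1) F"
    using local_lipschitz_compact_implies_lipschitz[where X = "cball 0 1" and T = "{0::real}" and f = "\<lambda>_. F"]
    by (auto simp: compact_cball)
  have "L-lipschitz_on {0..1} B"
  proof (rule lipschitz_onI)
    fix x y :: real assume xy: "x \<in> {0..1}" "y \<in> {0..1}"
    have "dist (F (of_real x)) (F (of_real y)) \<le> L * dist (of_real x :: complex) (of_real y)"
      using L xy by (intro lipschitz_onD) auto
    then show "dist (B x) (B y) \<le> L * dist x y"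
      using xy F(4)[of "of_real x"] F(4)[of "of_real y"]
      by (simp add: dist_norm of_real_diff[symmetric] del: of_real_diff)
  qed (use L lipschitz_on_nonneg in auto)
  then show ?thesis by (rule that)
qed

text \<open>Outside the disc the field keeps its boundary value. The extension is bounded and
  globally Lipschitz, so its flow exists for all times, including those before entry and after
  escape.\<close>

definition radial_ext :: "(real \<Rightarrow> real) \<Rightarrow> complex \<Rightarrow> real" where
  "radial_ext B z = B (min 1 (norm z))"

lemma radial_ext_lipschitz:
  assumes "K-lipschitz_on {0..1} B"
  shows "K-lipschitz_on UNIV (radial_ext B)"
proof (rule lipschitz_onI)
  fix x y :: complex
  have "dist (radial_ext B x) (radial_ext B y) \<le> K * dist (min 1 (norm x)) (min 1 (norm y))"
    unfolding radial_ext_def using assms by (intro lipschitz_onD) auto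
  also have "\<dots> \<le> K * dist x y"
  proof (rule mult_left_mono)
    have "\<bar>norm x - norm y\<bar> \<le> norm (x - y)" by (rule norm_triangle_ineq3)
    then show "dist (min 1 (norm x)) (min 1 (norm y)) \<le> dist x y"
      unfolding dist_norm real_norm_def by linarith
  qed (use assms lipschitz_on_nonneg in auto)
  finally show "dist (radial_ext B x) (radial_ext B y) \<le> K * dist x y" .
qed (use assms lipschitz_on_nonneg in auto)

lemma radial_ext_bounded:
  assumes "K-lipschitz_on {0..1} B"
  shows "\<bar>radial_ext B z\<bar> \<le> \<bar>B 0\<bar> + K"
proof -
  have "dist (radial_ext B z) (B 0) \<le> K * dist (min 1 (norm z)) 0"
    unfolding radial_ext_def using assms by (intro lipschitz_onD) auto
  also have "\<dots> \<le> K * 1"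
    using assms lipschitz_on_nonneg by (intro mult_left_mono) auto
  finally show ?thesis by (simp add: dist_real_def)
qed

section \<open>The first turning point\<close>

text \<open>Increments of \<open>f\<close> over unit intervals tend to \<open>l - l = 0\<close>, and
  by the mean value theorem they are values of \<open>f'\<close> at points that tend to
  infinity.\<close>

lemma tendsto_deriv_at_top_zero:
  fixes f f' :: "real \<Rightarrow> real"
  assumes der: "\<And>t. (f has_real_derivative f' t) (at t)"
    and f: "(f \<longlongrightarrow> l) at_top" and f': "(f' \<longlongrightarrow> m) at_top"
  shows "m = 0"
proof -
  have "\<exists>z. real n < z \<and> f (real n + 1) - f (real n) = f' z" for n
    using MVT2[of "real n" "real n + 1" f f'] der by auto
  then obtain z where z: "\<And>n. real n < z n" "\<And>n. f (real n + 1) - f (real n) = f' (z n)"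
    by metis
  have "filterlim z at_top sequentially"
    by (rule filterlim_at_top_mono[OF filterlim_real_sequentially]) (simp add: z(1) less_imp_le)
  then have "(\<lambda>n. f' (z n)) \<longlonglongrightarrow> m"
    by (rule filterlim_compose[OF f'])
  moreover have "filterlim (\<lambda>n. real n + 1) at_top sequentially"
    by (rule filterlim_at_top_mono[OF filterlim_real_sequentially]) auto
  then have "(\<lambda>n. f (real n + 1) - f (real n)) \<longlonglongrightarrow> l - l"
    by (intro tendsto_diff filterlim_compose[OF f] filterlim_real_sequentially)
  ultimately show ?thesis
    using z(2) LIMSEQ_unique by force
qed

text \<open>If \<open>\<eta>\<close> stayed negative, \<open>\<rho>\<close> would decrease to a
  limit in \<open>[a,1)\<close>. There \<open>W\<close> would vanish, so the limit would be
  \<open>a\<close>; but then the derivative of the convergent function \<open>\<eta>\<close> would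
  tend to \<open>2 * W' a\<close>, which is not 0. Simplicity of the zero thus makes the arrival
  time finite.\<close>

lemma first_turning_point:
  fixes \<rho> \<eta> W W' :: "real \<Rightarrow> real"
  assumes d\<rho>: "\<And>t. (\<rho> has_real_derivative \<eta> t) (at t)"
    and d\<eta>: "\<And>t. (\<eta> has_real_derivative 2 * W' (\<rho> t)) (at t)"
    and energy: "\<And>t. (\<eta> t)\<^sup>2 = 4 * W (\<rho> t)"
    and init: "\<rho> 0 = 1" "\<eta> 0 \<le> 0" "\<eta> 0 = 0 \<Longrightarrow> W' 1 < 0"
    and a: "a < 1" "W a = 0" "W' a \<noteq> 0" "\<And>x. a < x \<Longrightarrow> x < 1 \<Longrightarrow> 0 < W x"
    and cont: "continuous_on {a..1} W" "continuous_on {a..1} W'"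
  obtains t0 where "0 < t0" "\<rho> t0 = a" "\<eta> t0 = 0"
    "\<And>t. 0 < t \<Longrightarrow> t < t0 \<Longrightarrow> \<eta> t < 0" "\<And>t. 0 < t \<Longrightarrow> t < t0 \<Longrightarrow> a < \<rho> t \<and> \<rho> t < 1"
proof -
  have cont\<rho>: "continuous_on S \<rho>" and cont\<eta>: "continuous_on S \<eta>" for S
    by (rule DERIV_continuous_on[OF has_field_derivative_at_within], rule d\<rho> d\<eta>)+
  \<comment> \<open>The squared radius decreases at once: either its first derivative at 0 is
    negative, or it vanishes and the second derivative \<open>2 * W' 1\<close> is negative.\<close>
  have "\<exists>e>0. \<forall>t. 0 < t \<longrightarrow> t < e \<longrightarrow> \<eta> t < 0"
  proof (cases "\<eta> 0 = 0")
    case True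
    then have "2 * W' (\<rho> 0) < 0" using init by simp
    from DERIV_neg_dec_right[OF d\<eta> this] show ?thesis
      using True by auto
  next
    case False
    then have "\<eta> 0 < 0" using init by simp
    moreover have "(\<eta> \<longlongrightarrow> \<eta> 0) (at_right 0)"
      using cont\<eta>[of UNIV] by (auto simp: continuous_on_def intro: tendsto_within_subset)
    ultimately have "\<forall>\<^sub>F t in at_right 0. \<eta> t < 0" by (auto dest: order_tendstoD(2))
    then show ?thesis unfolding eventually_at_right_field by auto
  qed
  then obtain e where e: "0 < e" "\<And>t. 0 < t \<Longrightarrow> t < e \<Longrightarrow> \<eta> t < 0" by auto
  have decr: "\<rho> u < \<rho> s"
    if "\<And>s. 0 < s \<Longrightarrow> s < t \<Longrightarrow> \<eta> s < 0" "0 \<le> s" "s < u" "u \<le> t" for s t u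
  proof (rule DERIV_neg_imp_decreasing_open[OF \<open>s < u\<close> _ cont\<rho>])
    fix x assume "s < x" "x < u"
    then show "\<exists>y. DERIV \<rho> x :> y \<and> y < 0"
      using d\<rho>[of x] that by (intro exI[of _ "\<eta> x"]) auto
  qed
  have bounds: "a \<le> \<rho> t \<and> \<rho> t < 1" if neg: "\<And>s. 0 < s \<Longrightarrow> s < t \<Longrightarrow> \<eta> s < 0" and pos: "0 < t" for t
  proof
    show "\<rho> t < 1" using decr[of t 0 t] neg pos init by simp
    show "a \<le> \<rho> t"
    proof (rule ccontr)
      \<comment> \<open>To fall below \<open>a\<close>, the function \<open>\<rho>\<close> has to
        take the value \<open>a\<close> at an earlier positive time, where the energy relation
        forces \<open>\<eta>\<close> to vanish.\<close>
      assume "\<not> a \<le> \<rho> t"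
      then obtain u where "0 \<le> u" "u \<le> t" "\<rho> u = a"
        using IVT2'[of \<rho> t a 0] init a(1) pos cont\<rho> by (auto simp: not_le)
      then have "0 < u" "u < t" "\<eta> u = 0"
        using init a energy[of u] \<open>\<not> a \<le> \<rho> t\<close> by (auto simp: less_le)
      with neg[of u] show False by simp
    qed
  qed
  have "\<exists>t>0. 0 \<le> \<eta> t"
  proof (rule ccontr)
    assume "\<not> (\<exists>t>0. 0 \<le> \<eta> t)"
    then have neg: "\<eta> t < 0" if "0 < t" for t using that by force
    have lb: "a \<le> \<rho> t" "\<rho> t < 1" if "0 < t" for t using bounds[of t] neg that by auto
    define l where "l = Inf (\<rho> ` {1..})"
    have bdd: "bdd_below (\<rho> ` {1..})" using lb by (intro bdd_belowI[of _ a]) auto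
    have l: "a \<le> l" unfolding l_def using lb by (intro cINF_greatest) auto
    have l1: "l < 1"
      using cINF_lower[OF bdd, of 1] lb(2)[of 1] by (simp add: l_def)
    have lim: "(\<rho> \<longlongrightarrow> l) at_top"
    proof (rule decreasing_tendsto)
      show "\<forall>\<^sub>F t in at_top. l \<le> \<rho> t"
        using eventually_ge_at_top[of 1] by eventually_elim (auto simp: l_def intro!: cINF_lower bdd)
      fix x assume "l < x"
      then obtain s where s: "1 \<le> s" "\<rho> s < x"
        unfolding l_def using cInf_lessD[of "\<rho> ` {1..}" x] by auto
      show "\<forall>\<^sub>F t in at_top. \<rho> t < x"
        using eventually_gt_at_top[of s]
      proof eventually_elim
        case (elim t)
        then show ?case using decr[of t s t] neg s by force
      qed
    qed
    have lim_comp: "((\<lambda>t. f (\<rho> t)) \<longlongrightarrow> f l) at_top" if "continuous_on {a..1} f" for f :: "real \<Rightarrow> real"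
      by (rule continuous_on_tendsto_compose[OF that lim])
        (use l l1 lb(1) lb(2)[THEN less_imp_le] in
          \<open>auto intro!: eventually_mono[OF eventually_gt_at_top[of 0]]\<close>)
    have lim\<eta>: "(\<eta> \<longlongrightarrow> - sqrt (4 * W l)) at_top"
    proof (rule Lim_transform_eventually)
      show "((\<lambda>t. - sqrt (4 * W (\<rho> t))) \<longlongrightarrow> - sqrt (4 * W l)) at_top"
        by (intro tendsto_intros lim_comp cont)
      show "\<forall>\<^sub>F t in at_top. - sqrt (4 * W (\<rho> t)) = \<eta> t"
        using eventually_gt_at_top[of 0]
        by eventually_elim (use neg in \<open>simp add: energy[symmetric] abs_of_neg\<close>)
    qed
    from tendsto_deriv_at_top_zero[OF d\<rho> lim this] have "W l = 0" by simp
    with a(4)[of l] l l1 have "l = a" by (cases "a < l") auto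
    have "((\<lambda>t. 2 * W' (\<rho> t)) \<longlongrightarrow> 2 * W' l) at_top"
      by (intro tendsto_intros lim_comp cont)
    from tendsto_deriv_at_top_zero[OF d\<eta> lim\<eta> this] show False
      using a(3) \<open>l = a\<close> by simp
  qed
  then obtain t1 where t1: "0 < t1" "0 \<le> \<eta> t1" by auto
  \<comment> \<open>The search starts at \<open>e/2\<close> because \<open>\<eta>\<close> may vanish
    at time 0. Since \<open>\<eta>\<close> is negative on \<open>(0,e)\<close>, the least element of
    \<open>Z\<close> is the first positive zero.\<close>
  define Z where "Z = {t \<in> {e/2..t1}. \<eta> t = 0}"
  have et1: "e/2 \<le> t1" using e(1) e(2)[OF t1(1)] t1(2) by force
  have e2: "\<eta> (e/2) < 0" using e by simp
  have "\<exists>x\<ge>e/2. x \<le> t1 \<and> \<eta> x = 0"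
    using e2 t1 et1 by (intro IVT') (auto intro: cont\<eta>)
  then have "Z \<noteq> {}" by (auto simp: Z_def)
  have "closed Z"
    unfolding Z_def by (rule continuous_closed_preimage_constant[OF cont\<eta>]) simp
  moreover have "bounded Z" unfolding Z_def by (rule bounded_subset[of "{e/2..t1}"]) auto
  ultimately have "compact Z" by (simp add: compact_eq_bounded_closed)
  then obtain t0 where t0: "t0 \<in> Z" "\<And>t. t \<in> Z \<Longrightarrow> t0 \<le> t"
    using compact_attains_inf[OF _ \<open>Z \<noteq> {}\<close>] by blast
  have t0_pos: "0 < t0" using t0(1) e by (simp add: Z_def)
  have neg: "\<eta> t < 0" if t: "0 < t" "t < t0" for t
  proof (rule ccontr)
    assume "\<not> \<eta> t < 0"
    then have nn: "0 \<le> \<eta> t" "e/2 \<le> t"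
      using e(2)[OF t(1)] e(1) by force+
    then have "\<exists>x\<ge>e/2. x \<le> t \<and> \<eta> x = 0"
      using e2 by (intro IVT') (auto intro: cont\<eta>)
    then obtain x where "e/2 \<le> x" "x \<le> t" "\<eta> x = 0" by blast
    then show False using t0 t by (force simp: Z_def)
  qed
  have \<eta>0: "\<eta> t0 = 0" using t0(1) by (simp add: Z_def)
  \<comment> \<open>A zero of \<open>\<eta>\<close> is a zero of \<open>W\<close> along the motion,
    and \<open>a\<close> is the only one in \<open>[a,1)\<close>.\<close>
  with energy[of t0] a(4)[of "\<rho> t0"] bounds[of t0] neg t0_pos have \<rho>0: "\<rho> t0 = a"
    by (cases "a < \<rho> t0") auto
  have "a < \<rho> t \<and> \<rho> t < 1" if "0 < t" "t < t0" for t
    using decr[of t0 t t0] decr[of t0 0 t] neg that \<rho>0 init by simp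
  with t0_pos \<rho>0 \<eta>0 neg show ?thesis by (rule that)
qed

section \<open>The reduced motion\<close>

text \<open>The field as a function of the squared radius. The absolute value and the minimum
  continue it to the whole line: evenly to negative arguments, and by the boundary value beyond
  1.\<close>

definition profile_sq :: "(real \<Rightarrow> real) \<Rightarrow> real \<Rightarrow> real" where
  "profile_sq B x = B (min 1 (sqrt \<bar>x\<bar>))"

text \<open>The flux as a function of the squared radius. Integrating from \<open>-1\<close> rather than \<open>0\<close>
  makes it two-sided differentiable at \<open>0\<close>.\<close>

definition flux_sq :: "(real \<Rightarrow> real) \<Rightarrow> real \<Rightarrow> real" where
  "flux_sq B x = integral {-1..x} (\<lambda>s. profile_sq B s / 2) - integral {-1..0} (\<lambda>s. profile_sq B s / 2)"

lemma profile_sq_power2 [simp]: "0 \<le> r \<Longrightarrow> r \<le> 1 \<Longrightarrow> profile_sq B (r\<^sup>2) = B r"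
  by (simp add: profile_sq_def)

lemma radial_ext_eq_profile_sq: "radial_ext B z = profile_sq B ((norm z)\<^sup>2)"
  by (simp add: radial_ext_def profile_sq_def)

lemma continuous_on_profile_sq:
  assumes "continuous_on {0..1} B"
  shows "continuous_on S (profile_sq B)"
  unfolding profile_sq_def
  by (rule continuous_on_compose2[OF assms]) (auto intro!: continuous_intros)

lemma flux_sq_0 [simp]: "flux_sq B 0 = 0"
  by (simp add: flux_sq_def)

lemma flux_sq_has_real_derivative:
  assumes "continuous_on {0..1} B" "-1 < x"
  shows "(flux_sq B has_real_derivative profile_sq B x / 2) (at x)"
proof -
  have "((\<lambda>u. integral {-1..u} (\<lambda>s. profile_sq B s / 2)) has_vector_derivative profile_sq B x / 2)
      (at x within {-1..})"
    using assms by (intro integral_has_vector_derivative_atLeast)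
      (auto intro!: continuous_intros continuous_on_profile_sq)
  moreover have "at x within {-1..} = at x"
    using assms by (intro at_within_interior) auto
  ultimately show ?thesis
    unfolding flux_sq_def[abs_def] has_real_derivative_iff_has_vector_derivative
    by (auto intro!: derivative_eq_intros simp del: integral_divide)
qed

text \<open>The substitution of the squared radius: \<open>flux_sq B (\<tau>\<^sup>2)\<close> has
  the derivative \<open>\<tau> * B \<tau>\<close> in \<open>\<tau>\<close>.\<close>

lemma flux_eq_flux_sq:
  assumes B: "continuous_on {0..1} B" and r: "0 \<le> r" "r \<le> 1"
  shows "flux B r = flux_sq B (r\<^sup>2)"
proof -
  have "((\<lambda>\<tau>. \<tau> * B \<tau>) has_integral flux_sq B (r\<^sup>2) - flux_sq B (0\<^sup>2)) {0..r}"
  proof (rule fundamental_theorem_of_calculus[OF r(1)])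
    fix x assume x: "x \<in> {0..r}"
    have "-1 < x\<^sup>2" using zero_le_power2[of x] by linarith
    have "((\<lambda>\<tau>. flux_sq B (\<tau>\<^sup>2)) has_real_derivative profile_sq B (x\<^sup>2) / 2 * (2 * x)) (at x)"
      by (rule DERIV_chain2[where g = "\<lambda>\<tau>. \<tau>\<^sup>2", OF flux_sq_has_real_derivative[OF B \<open>-1 < x\<^sup>2\<close>]])
        (auto intro!: derivative_eq_intros)
    then show "((\<lambda>\<tau>. flux_sq B (\<tau>\<^sup>2)) has_vector_derivative x * B x) (at x within {0..r})"
      using x r by (simp add: has_real_derivative_iff_has_vector_derivative[symmetric]
          has_field_derivative_at_within mult.commute)
  qed
  then show ?thesis by (simp add: flux_def integral_unique)
qed

text \<open>For a trajectory with energy \<open>E\<close> and angular momentum \<open>p\<close>, the squared radius \<open>\<rho>\<close> satisfies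
  \<open>\<rho>' ^ 2 = 4 * radicand B p E \<rho>\<close>, without the singularity at the origin of the equation
  for the radius.\<close>

definition radicand :: "(real \<Rightarrow> real) \<Rightarrow> real \<Rightarrow> real \<Rightarrow> real \<Rightarrow> real" where
  "radicand B p E x = 2 * E * x - (p - flux_sq B x)\<^sup>2"

definition radicand_deriv :: "(real \<Rightarrow> real) \<Rightarrow> real \<Rightarrow> real \<Rightarrow> real \<Rightarrow> real" where
  "radicand_deriv B p E x = 2 * E + (p - flux_sq B x) * profile_sq B x"

lemma radicand_has_real_derivative:
  assumes "continuous_on {0..1} B" "-1 < x"
  shows "(radicand B p E has_real_derivative radicand_deriv B p E x) (at x)"
  unfolding radicand_def[abs_def] radicand_deriv_def
  by (auto intro!: derivative_eq_intros flux_sq_has_real_derivative[OF assms] simp: field_simps)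

lemma continuous_on_flux_sq:
  assumes "continuous_on {0..1} B" "S \<subseteq> {-1<..}"
  shows "continuous_on S (flux_sq B)"
  by (rule DERIV_continuous_on[OF has_field_derivative_at_within], rule flux_sq_has_real_derivative)
    (use assms in auto)

lemma continuous_on_radicand:
  assumes "continuous_on {0..1} B" "S \<subseteq> {-1<..}"
  shows "continuous_on S (radicand B p E)" "continuous_on S (radicand_deriv B p E)"
  unfolding radicand_def[abs_def] radicand_deriv_def[abs_def]
  by (intro continuous_intros continuous_on_flux_sq continuous_on_profile_sq assms)+

section \<open>Translation between the effective potential and the radicand\<close>

lemma eff_potential_eq:
  assumes "continuous_on {0..1} B" "0 < r" "r \<le> 1"
  shows "eff_potential B p r = E - radicand B p E (r\<^sup>2) / (2 * r\<^sup>2)"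
  using assms by (simp add: eff_potential_def radicand_def flux_eq_flux_sq field_simps)

lemma eff_potential_eq_iff:
  assumes "continuous_on {0..1} B" "0 < r" "r \<le> 1"
  shows "eff_potential B p r = E \<longleftrightarrow> radicand B p E (r\<^sup>2) = 0"
  using assms by (simp add: eff_potential_eq[where E = E])

text \<open>At a zero of the radicand only the numerator of the quotient contributes to the
  derivative. A negative slope of the potential therefore means a simple zero at which the radicand
  increases.\<close>

lemma deriv_eff_potential:
  assumes B: "continuous_on {0..1} B" and r: "0 < r" "r < 1" and "radicand B p E (r\<^sup>2) = 0"
  shows "deriv (eff_potential B p) r = - radicand_deriv B p E (r\<^sup>2) / r"
proof (rule DERIV_imp_deriv, rule has_field_derivative_transform_within_open)
  have "-1 < r\<^sup>2" using zero_le_power2[of r] by linarith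
  have "((\<lambda>r. radicand B p E (r\<^sup>2)) has_real_derivative radicand_deriv B p E (r\<^sup>2) * (2 * r)) (at r)"
    by (rule DERIV_chain2[where g = "\<lambda>r. r\<^sup>2", OF radicand_has_real_derivative[OF B \<open>-1 < r\<^sup>2\<close>]])
      (auto intro!: derivative_eq_intros)
  then show "((\<lambda>r. E - radicand B p E (r\<^sup>2) / (2 * r\<^sup>2)) has_real_derivative
      - radicand_deriv B p E (r\<^sup>2) / r) (at r)"
    using assms by (auto intro!: derivative_eq_intros simp: field_simps power2_eq_square)
  show "E - radicand B p E (x\<^sup>2) / (2 * x\<^sup>2) = eff_potential B p x" if "x \<in> {0<..<1}" for x
    using eff_potential_eq[OF B, of x p E] that by simp
qed (use r in auto)

text \<open>The positive derivative makes the radicand positive just to the right of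
  \<open>a\<close>; by the intermediate value theorem it could only lose its sign at a further
  zero.\<close>

lemma radicand_pos:
  assumes B: "continuous_on {0..1} B" and a: "0 \<le> a" "radicand B p E a = 0" "0 < radicand_deriv B p E a"
    and ne: "\<And>x. a < x \<Longrightarrow> x < 1 \<Longrightarrow> radicand B p E x \<noteq> 0" and x: "a < x" "x < 1"
  shows "0 < radicand B p E x"
proof (rule ccontr)
  assume neg: "\<not> 0 < radicand B p E x"
  have "(radicand B p E has_real_derivative radicand_deriv B p E a) (at a)"
    using a by (intro radicand_has_real_derivative B) auto
  from DERIV_pos_inc_right[OF this a(3)] obtain d
    where d: "0 < d" "\<And>h. 0 < h \<Longrightarrow> h < d \<Longrightarrow> 0 < radicand B p E (a + h)"
    using a(2) by auto
  define h where "h = min (d / 2) ((x - a) / 2)"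
  have h: "0 < h" "h < d" "a + h < x" using d(1) x by (auto simp: h_def min_def field_simps)
  have "\<exists>y\<ge>a + h. y \<le> x \<and> radicand B p E y = 0"
    using d(2)[OF h(1,2)] neg h a(1)
    by (intro IVT2' continuous_on_radicand B) auto
  then show False using ne h x by force
qed

text \<open>All four facts are read off from \<open>m = cnj q * v\<close>, whose real part is
  \<open>\<rho>' / 2\<close> and whose imaginary part is the kinetic angular momentum. It satisfies
  \<open>m' = 2 * E - \<i> * b * m\<close> and has squared modulus
  \<open>\<rho> * 2 * E\<close>.\<close>

lemma newton_reduced:
  fixes q v :: "real \<Rightarrow> complex"
  assumes B: "continuous_on {0..1} B"
    and dq: "\<And>t. (q has_vector_derivative v t) (at t)"
    and dv: "\<And>t. (v has_vector_derivative radial_ext B (q t) *\<^sub>R (- \<i> * v t)) (at t)"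
    and speed: "\<And>t. (norm (v t))\<^sup>2 = 2 * E"
    and p: "p = Im (cnj (q 0) * v 0) + flux_sq B ((norm (q 0))\<^sup>2)"
  shows "((\<lambda>t. (norm (q t))\<^sup>2) has_real_derivative 2 * Re (cnj (q t) * v t)) (at t)"
    and "((\<lambda>t. 2 * Re (cnj (q t) * v t)) has_real_derivative
      2 * radicand_deriv B p E ((norm (q t))\<^sup>2)) (at t)"
    and "Im (cnj (q t) * v t) = p - flux_sq B ((norm (q t))\<^sup>2)"
    and "(2 * Re (cnj (q t) * v t))\<^sup>2 = 4 * radicand B p E ((norm (q t))\<^sup>2)"
proof -
  let ?m = "\<lambda>t. cnj (q t) * v t" and ?\<rho> = "\<lambda>t. (norm (q t))\<^sup>2" and ?b = "\<lambda>t. radial_ext B (q t)"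
  have dcq: "((\<lambda>t. cnj (q t)) has_vector_derivative cnj (v t)) (at t)" for t
    by (rule bounded_linear.has_vector_derivative[OF bounded_linear_cnj dq])
  have \<rho>: "?\<rho> t = Re (cnj (q t) * q t)" for t
    by (simp add: cmod_power2) (simp add: power2_eq_square)
  have d\<rho>: "(?\<rho> has_real_derivative 2 * Re (?m t)) (at t)" for t
    unfolding \<rho> has_real_derivative_iff_has_vector_derivative
    using bounded_linear.has_vector_derivative[OF bounded_linear_Re
        has_vector_derivative_mult[OF dcq dq, of t]]
    by (simp add: algebra_simps)
  then show "(?\<rho> has_real_derivative 2 * Re (?m t)) (at t)" .
  have dm: "(?m has_vector_derivative of_real (2 * E) - \<i> * of_real (?b t) * ?m t) (at t)" for t
  proof -
    have "cnj (v t) * v t = of_real (2 * E)"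
      unfolding speed[of t, symmetric] by (metis complex_norm_square mult.commute of_real_power)
    then show ?thesis
      using has_vector_derivative_mult[OF dcq dv, of t]
      by (simp add: scaleR_conv_of_real algebra_simps)
  qed
  have dRe: "((\<lambda>t. Re (?m t)) has_real_derivative 2 * E + ?b t * Im (?m t)) (at t)" for t
    unfolding has_real_derivative_iff_has_vector_derivative
    using bounded_linear.has_vector_derivative[OF bounded_linear_Re dm[of t]]
    by (simp add: algebra_simps)
  have dIm: "((\<lambda>t. Im (?m t)) has_real_derivative - ?b t * Re (?m t)) (at t)" for t
    unfolding has_real_derivative_iff_has_vector_derivative
    using bounded_linear.has_vector_derivative[OF bounded_linear_Im dm[of t]]
    by (simp add: algebra_simps)
  have "((\<lambda>t. Im (?m t) + flux_sq B (?\<rho> t)) has_real_derivative 0) (at t)" for t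
  proof -
    have "-1 < ?\<rho> t" using zero_le_power2[of "norm (q t)"] by linarith
    \<comment> \<open>The change of the kinetic angular momentum is balanced by the change of the
      flux, which is the conservation of \<open>p\<close>.\<close>
    have 0: "- ?b t * Re (?m t) + profile_sq B (?\<rho> t) / 2 * (2 * Re (?m t)) = 0"
      by (simp add: radial_ext_eq_profile_sq)
    from DERIV_add[OF dIm[of t] DERIV_chain2[OF flux_sq_has_real_derivative[OF B \<open>-1 < ?\<rho> t\<close>] d\<rho>]]
    show ?thesis unfolding 0 .
  qed
  then have "Im (?m t) + flux_sq B (?\<rho> t) = Im (?m 0) + flux_sq B (?\<rho> 0)" for t
    using DERIV_isconst_all by blast
  then have Im: "Im (?m t) = p - flux_sq B (?\<rho> t)" for t
    unfolding p by (simp add: eq_diff_eq)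
  then show "Im (?m t) = p - flux_sq B (?\<rho> t)" .
  show "((\<lambda>t. 2 * Re (?m t)) has_real_derivative 2 * radicand_deriv B p E (?\<rho> t)) (at t)"
    using DERIV_cmult[OF dRe[of t], of 2]
    unfolding Im radicand_deriv_def radial_ext_eq_profile_sq by (simp add: mult.commute)
  have "(Re (?m t))\<^sup>2 + (Im (?m t))\<^sup>2 = ?\<rho> t * (norm (v t))\<^sup>2"
    unfolding cmod_power2[symmetric] by (simp add: norm_mult power_mult_distrib)
  moreover have "(2 * x)\<^sup>2 = 4 * (2 * E * y - z\<^sup>2)" if "x\<^sup>2 + z\<^sup>2 = y * (2 * E)" for x y z
    using that by (simp add: power_mult_distrib algebra_simps)
  ultimately show "(2 * Re (?m t))\<^sup>2 = 4 * radicand B p E (?\<rho> t)"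
    unfolding speed Im radicand_def by blast
qed

section \<open>Time reversal and polar angle\<close>

text \<open>The fundamental theorem is applied to \<open>F\<close> composed with the inverse of
  \<open>g\<close>, with derivatives in the interior and mere continuity at the ends. So
  \<open>g'\<close> may vanish and \<open>f\<close> may be singular at an end point, as happens at
  the turning radius, and integrability of \<open>f\<close> is obtained along the way.\<close>

lemma has_integral_substitution_decreasing:
  fixes F f g g' :: "real \<Rightarrow> real"
  assumes "a < b" and contg: "continuous_on {a..b} g"
    and dg: "\<And>t. a < t \<Longrightarrow> t < b \<Longrightarrow> (g has_real_derivative g' t) (at t)"
    and neg: "\<And>t. a < t \<Longrightarrow> t < b \<Longrightarrow> g' t < 0"
    and contF: "continuous_on {a..b} F"
    and dF: "\<And>t. a < t \<Longrightarrow> t < b \<Longrightarrow> (F has_real_derivative f (g t) * g' t) (at t)"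
  shows "(f has_integral F a - F b) {g b..g a}"
proof -
  have decr: "g u < g s" if "a \<le> s" "s < u" "u \<le> b" for s u
  proof (rule DERIV_neg_imp_decreasing_open[OF \<open>s < u\<close>])
    show "\<exists>y. DERIV g x :> y \<and> y < 0" if "s < x" "x < u" for x
      using dg[of x] neg[of x] that \<open>a \<le> s\<close> \<open>u \<le> b\<close> by (intro exI[of _ "g' x"]) auto
    show "continuous_on {s..u} g"
      by (rule continuous_on_subset[OF contg]) (use that in auto)
  qed
  have inj: "inj_on g {a..b}"
    by (rule inj_onI) (metis atLeastAtMost_iff decr less_irrefl linorder_neqE_linordered_idom)
  define h where "h = the_inv_into {a..b} g"
  have hg: "h (g t) = t" if "t \<in> {a..b}" for t
    unfolding h_def using inj that by (rule the_inv_into_f_f)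
  have surj: "\<exists>t\<in>{a..b}. g t = r" if "r \<in> {g b..g a}" for r
    using IVT2'[of g b r a] that \<open>a < b\<close> contg by auto
  have gh: "g (h r) = r" "h r \<in> {a..b}" if "r \<in> {g b..g a}" for r
    using surj[OF that] hg by auto
  have image: "g ` {a..b} = {g b..g a}"
  proof
    show "g ` {a..b} \<subseteq> {g b..g a}"
      using decr[of a] decr[of _ b] \<open>a < b\<close> by (force simp: le_less)
  qed (use surj in force)
  have conth: "continuous_on {g b..g a} h"
    using continuous_on_inv[OF contg, of h] hg image by auto
  have "((\<lambda>r. - f r) has_integral (- F (h (g a))) - (- F (h (g b)))) {g b..g a}"
  proof (rule fundamental_theorem_of_calculus_interior)
    show "g b \<le> g a" using decr[of a b] \<open>a < b\<close> by simp
    show "continuous_on {g b..g a} (\<lambda>r. - F (h r))"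
      by (intro continuous_intros continuous_on_compose2[OF contF conth]) (use gh in auto)
    fix r assume r: "r \<in> {g b<..<g a}"
    then have rcl: "r \<in> {g b..g a}" by simp
    have "h r \<noteq> a" "h r \<noteq> b" using gh[OF rcl] r by auto
    then have t: "a < h r" "h r < b" using gh[OF rcl] by auto
    have "isCont h r"
      using conth r continuous_on_interior[of "{g b..g a}" h r] by (auto simp: interior_atLeastAtMost_real)
    then have "(h has_real_derivative inverse (g' (h r))) (at r)"
      using r t neg[of "h r"] gh
      by (intro DERIV_inverse_function[where f = g and a = "g b" and b = "g a"] dg) auto
    then have "((\<lambda>r. - F (h r)) has_real_derivative - (f (g (h r)) * g' (h r) * inverse (g' (h r)))) (at r)"
      by (intro DERIV_minus DERIV_chain2[where g = h, OF dF[OF t]])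
    then have "((\<lambda>r. - F (h r)) has_real_derivative - f r) (at r)"
      using gh[OF rcl] neg[OF t] by (simp add: mult.assoc)
    then show "((\<lambda>r. - F (h r)) has_vector_derivative - f r) (at r)"
      by (simp add: has_real_derivative_iff_has_vector_derivative)
  qed
  from has_integral_neg[OF this] show ?thesis using hg \<open>a < b\<close> by simp
qed

text \<open>The map \<open>z \<mapsto> c * cnj z\<close> is a reflection in a line through the
  origin. It changes the sign of the magnetic force, as does time reversal, so the combination
  preserves solutions for a radial field. The conditions at \<open>t0\<close> say that the
  transformed solution has the same position and velocity there; uniqueness does the rest.\<close>

lemma newton_reflection:
  fixes q v :: "real \<Rightarrow> complex"
  assumes lip: "K-lipschitz_on UNIV b" and radial: "\<And>z w. norm z = norm w \<Longrightarrow> b z = b w"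
    and dq: "\<And>t. (q has_vector_derivative v t) (at t)"
    and dv: "\<And>t. (v has_vector_derivative b (q t) *\<^sub>R (- \<i> * v t)) (at t)"
    and speed: "\<And>t. norm (v t) \<le> R"
    and c: "norm c = 1" "c * cnj (q t0) = q t0" "c * cnj (v t0) = - v t0"
    and s: "0 \<le> s"
  shows "q (t0 + s) = c * cnj (q (t0 - s))" "v (t0 + s) = - c * cnj (v (t0 - s))"
proof -
  have shift: "((\<lambda>t. x (t0 + t)) has_vector_derivative y) (at t)"
    if "(x has_vector_derivative y) (at (t0 + t))" for x :: "real \<Rightarrow> complex" and y t
  proof -
    have "((+) t0 has_vector_derivative 1) (at t)" by (auto intro!: derivative_eq_intros)
    from vector_diff_chain_at[OF this that] show ?thesis by (simp add: o_def)
  qed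
  have flip: "((\<lambda>t. d * cnj (x (t0 - t))) has_vector_derivative - (d * cnj y)) (at t)"
    if "(x has_vector_derivative y) (at (t0 - t))" for x :: "real \<Rightarrow> complex" and y d t
  proof -
    have "((-) t0 has_vector_derivative - 1) (at t)" by (auto intro!: derivative_eq_intros)
    from vector_diff_chain_at[OF this that]
    have "((\<lambda>t. x (t0 - t)) has_vector_derivative - y) (at t)" by (simp add: o_def)
    from has_vector_derivative_mult_right[OF
        bounded_linear.has_vector_derivative[OF bounded_linear_cnj this], of d]
    show ?thesis by simp
  qed
  have refl: "((\<lambda>t. - c * cnj (v (t0 - t))) has_vector_derivative
      b (c * cnj (q (t0 - t))) *\<^sub>R (- \<i> * (- c * cnj (v (t0 - t))))) (at t)" for t
  proof -
    have "b (c * cnj (q (t0 - t))) = b (q (t0 - t))"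
      by (rule radial) (simp add: norm_mult c)
    then show ?thesis
      using flip[OF dv, of "- c" t] by (simp add: scaleR_conv_of_real mult_ac)
  qed
  have dp: "((\<lambda>t. c * cnj (q (t0 - t))) has_vector_derivative - c * cnj (v (t0 - t))) (at t)" for t
    using flip[OF dq, of c t] by simp
  note unique = newton_unique[OF lip, where s = s and t = s and R = R
      and q = "\<lambda>t. q (t0 + t)" and q' = "\<lambda>t. v (t0 + t)"
      and p = "\<lambda>t. c * cnj (q (t0 - t))" and p' = "\<lambda>t. - c * cnj (v (t0 - t))"]
  note ders = shift[OF dq, THEN has_vector_derivative_at_within]
    shift[OF dv, THEN has_vector_derivative_at_within]
    dp[THEN has_vector_derivative_at_within] refl[THEN has_vector_derivative_at_within]
  have bound: "norm (- c * cnj (v (t0 - t))) \<le> R" for t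
    using speed[of "t0 - t"] c by (simp add: norm_mult)
  have init: "q (t0 + 0) = c * cnj (q (t0 - 0))" "v (t0 + 0) = - c * cnj (v (t0 - 0))"
    using c by simp_all
  have "s \<in> {0..s}" using s by simp
  note unique = unique[OF ders bound init this]
  show "q (t0 + s) = c * cnj (q (t0 - s))" "v (t0 + s) = - c * cnj (v (t0 - s))"
    by (rule unique)+
qed

text \<open>The angle obtained by integrating \<open>w\<close> is the polar angle up to time
  \<open>t0\<close>, where \<open>q\<close> may reach the origin. In that event the second
  conclusion still gives the line along which the particle moves: \<open>v t0\<close> is a real
  multiple of \<open>cis (\<psi> t0)\<close>.\<close>

lemma polar_form:
  fixes q v :: "real \<Rightarrow> complex"
  assumes t0: "0 < t0"
    and dq: "\<And>t. (q has_vector_derivative v t) (at t)"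
    and contv: "continuous_on {0..t0} v"
    and nz: "\<And>t. 0 \<le> t \<Longrightarrow> t < t0 \<Longrightarrow> q t \<noteq> 0"
    and ang: "\<And>t. 0 \<le> t \<Longrightarrow> t \<le> t0 \<Longrightarrow> Im (cnj (q t) * v t) = (norm (q t))\<^sup>2 * w t"
    and contw: "continuous_on {0..t0} w"
    and d\<psi>: "\<And>t. 0 \<le> t \<Longrightarrow> t \<le> t0 \<Longrightarrow> (\<psi> has_real_derivative w t) (at t within {0..t0})"
    and init: "q 0 = cis (\<psi> 0)"
  shows "q t0 = norm (q t0) * cis (\<psi> t0)"
    and "Im (v t0 * cis (- \<psi> t0)) = norm (q t0) * w t0"
proof -
  have contq: "continuous_on S q" for S
    using dq by (intro continuous_on_vector_derivative) (auto intro: has_vector_derivative_at_within)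
  have cont\<psi>: "continuous_on {0..t0} \<psi>"
    using d\<psi> by (intro DERIV_continuous_on) auto
  \<comment> \<open>Polar coordinates are available only before \<open>t0\<close>; identities are
    carried to \<open>t0\<close> by continuity.\<close>
  have limit: "f t0 = g t0"
    if "continuous_on {0..t0} f" "continuous_on {0..t0} g" "\<And>t. 0 \<le> t \<Longrightarrow> t < t0 \<Longrightarrow> f t = g t"
    for f g :: "real \<Rightarrow> 'b::real_normed_vector"
  proof -
    have "f t0 - g t0 = 0"
      by (rule continuous_constant_on_closure[where S = "{0..<t0}" and f = "\<lambda>t. f t - g t"])
        (use that t0 in \<open>auto intro!: continuous_intros\<close>)
    then show ?thesis by simp
  qed
  \<comment> \<open>The direction of \<open>q t\<close> turned back by \<open>\<psi> t\<close>; it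
    is shown to be constant, hence equal to its initial value 1.\<close>
  define Z where "Z t = inverse (norm (q t)) *\<^sub>R (q t * cis (- \<psi> t))" for t
  have "(Z has_vector_derivative 0) (at t within {0..<t0})" if t: "t \<in> {0..<t0}" for t
  proof -
    define m where "m = cnj (q t) * v t"
    have q0: "q t \<noteq> 0" using nz t by simp
    have d\<psi>': "(\<psi> has_real_derivative w t) (at t within {0..<t0})"
      using d\<psi>[of t] t by (auto intro: DERIV_subset)
    have dcis: "((\<lambda>t. cis (- \<psi> t)) has_vector_derivative - (\<i> * of_real (w t)) * cis (- \<psi> t)) (at t within {0..<t0})"
      using d\<psi>' by (auto simp: has_vector_derivative_def has_field_derivative_def scaleR_conv_of_real
          mult_ac intro!: derivative_eq_intros)
    have dn: "((\<lambda>t. norm (q t)) has_real_derivative Re m / norm (q t)) (at t within {0..<t0})"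
    proof -
      have "(q has_derivative (\<lambda>h. h *\<^sub>R v t)) (at t within {0..<t0})"
        using dq[of t, THEN has_vector_derivative_at_within] by (simp add: has_vector_derivative_def)
      from has_derivative_compose[OF this has_derivative_norm[OF q0]]
      have "((\<lambda>t. norm (q t)) has_derivative (\<lambda>h. (h *\<^sub>R v t) \<bullet> sgn (q t))) (at t within {0..<t0})" .
      moreover have "(h *\<^sub>R v t) \<bullet> sgn (q t) = h * (Re m / norm (q t))" for h
        by (simp add: m_def sgn_div_norm inner_complex_def divide_simps) (simp add: algebra_simps)
      moreover have "(*) (Re m / norm (q t)) = (\<lambda>h. h * (Re m / norm (q t)))"
        by (simp add: fun_eq_iff)
      ultimately show ?thesis by (simp add: has_field_derivative_def)
    qed
    have m: "m = of_real (Re m) + \<i> * of_real ((norm (q t))\<^sup>2 * w t)"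
      using ang[of t] t by (simp add: m_def complex_eq_iff)
    have "of_real ((norm (q t))\<^sup>2) * v t = m * q t"
      unfolding m_def complex_norm_square by (simp add: mult_ac)
    \<comment> \<open>The logarithmic derivative of \<open>q\<close>: its real part is cancelled in
      \<open>Z\<close> by the normalisation, its imaginary part by
      \<open>cis (- \<psi> t)\<close>.\<close>
    then have v: "v t = (of_real (Re m / (norm (q t))\<^sup>2) + \<i> * of_real (w t)) * q t"
      using q0 by (subst (asm) m) (simp add: field_simps)
    have "(Z has_vector_derivative
        inverse (norm (q t)) *\<^sub>R (q t * (- (\<i> * of_real (w t)) * cis (- \<psi> t)) + v t * cis (- \<psi> t))
        + (- (inverse (norm (q t)) * (Re m / norm (q t)) * inverse (norm (q t)))) *\<^sub>R (q t * cis (- \<psi> t)))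
        (at t within {0..<t0})"
      unfolding Z_def
      by (intro has_vector_derivative_scaleR has_vector_derivative_mult DERIV_inverse' dcis dn
          has_vector_derivative_at_within[OF dq]) (use q0 in simp)
    also have "inverse (norm (q t)) *\<^sub>R (q t * (- (\<i> * of_real (w t)) * cis (- \<psi> t)) + v t * cis (- \<psi> t))
        + (- (inverse (norm (q t)) * (Re m / norm (q t)) * inverse (norm (q t)))) *\<^sub>R (q t * cis (- \<psi> t)) = 0"
      unfolding v using q0 by (simp add: scaleR_conv_of_real field_simps power2_eq_square)
    finally show ?thesis .
  qed
  then obtain k where k: "\<And>t. t \<in> {0..<t0} \<Longrightarrow> Z t = k"
    using has_vector_derivative_zero_constant[of "{0..<t0}" Z] by auto
  have "k = 1"
    using k[of 0] t0 init by (simp add: Z_def cis_mult)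
  have polar: "q t = norm (q t) * cis (\<psi> t)" if "0 \<le> t" "t < t0" for t
  proof -
    have "q t * cis (- \<psi> t) = norm (q t)"
      using k[of t] nz[OF that] that by (simp add: \<open>k = 1\<close> Z_def scaleR_conv_of_real field_simps)
    then have "q t * cis (- \<psi> t) * cis (\<psi> t) = norm (q t) * cis (\<psi> t)" by simp
    then show ?thesis by (simp add: mult.assoc cis_mult)
  qed
  show "q t0 = norm (q t0) * cis (\<psi> t0)"
    by (rule limit) (use polar in \<open>auto intro!: continuous_intros contq cont\<psi>\<close>)
  show "Im (v t0 * cis (- \<psi> t0)) = norm (q t0) * w t0"
  proof (rule limit)
    fix t assume t: "0 \<le> t" "t < t0"
    have "cnj (q t) = norm (q t) * cis (- \<psi> t)"
      by (subst polar[OF t]) (simp add: cis_cnj)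
    then have "norm (q t) * Im (v t * cis (- \<psi> t)) = norm (q t) * (norm (q t) * w t)"
      using ang[of t] t by (simp add: power2_eq_square algebra_simps)
    then show "Im (v t * cis (- \<psi> t)) = norm (q t) * w t" using nz[OF t] by simp
  qed (auto intro!: continuous_intros contq contv contw cont\<psi>)
qed

section \<open>Scattering\<close>

text \<open>For \<open>a = 0\<close> also \<open>p = 0\<close>, and the quotient of
  \<open>p - flux_sq B x\<close> by \<open>x\<close> has a removable singularity at 0, because
  \<open>flux_sq\<close> vanishes and is differentiable there. Caratheodory's form of the derivative
  supplies the continuous quotient.\<close>

lemma angular_velocity_extension:
  assumes B: "continuous_on {0..1} B" and a: "0 \<le> a" "a = 0 \<Longrightarrow> p = 0"
  obtains w where "continuous_on {a..1} w" "\<And>x. x \<in> {a..1} \<Longrightarrow> x * w x = p - flux_sq B x"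
proof (cases "a = 0")
  case False
  then have "continuous_on {a..1} (\<lambda>x. (p - flux_sq B x) / x)"
    using a by (intro continuous_intros continuous_on_flux_sq B) auto
  then show ?thesis by (rule that) (use False a in auto)
next
  case True
  have d: "(flux_sq B has_real_derivative profile_sq B 0 / 2) (at 0)"
    by (rule flux_sq_has_real_derivative[OF B]) simp
  then obtain g where g: "\<And>x. flux_sq B x = g x * x" "isCont g 0"
    unfolding CARAT_DERIV by auto
  have "continuous_on {0..1} g"
  proof (intro continuous_at_imp_continuous_on ballI)
    fix x :: real assume x: "x \<in> {0..1}"
    show "isCont g x"
    proof (cases "x = 0")
      case False
      have "isCont (\<lambda>x. flux_sq B x / x) x"
        using False x
        by (intro isCont_divide DERIV_isCont[OF flux_sq_has_real_derivative[OF B]] continuous_ident) auto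
      moreover have "\<forall>\<^sub>F y in nhds x. flux_sq B y / y = g y"
        using False x by (intro eventually_mono[OF eventually_nhds_in_open[of "{0<..}"]]) (auto simp: g(1))
      ultimately show ?thesis by (rule isCont_cong[THEN iffD1, rotated])
    qed (use g in simp)
  qed
  then show ?thesis
    by (intro that[of "\<lambda>x. - g x"]) (use True a g in \<open>auto intro!: continuous_intros\<close>)
qed

text \<open>Uniqueness gives agreement with the flow as long as both are defined. If
  \<open>J\<close> missed \<open>T\<close>, the flow on \<open>{0..T}\<close> would be a proper
  continuation within the disc, against maximality.\<close>

lemma trajectory_follows_flow:
  assumes lip: "K-lipschitz_on {0..1} B" and traj: "trajectory B J q q'"
    and dQ: "\<And>t. (Q has_vector_derivative V t) (at t)"
    and dV: "\<And>t. (V has_vector_derivative radial_ext B (Q t) *\<^sub>R (- \<i> * V t)) (at t)"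
    and speed: "\<And>t. norm (V t) \<le> R"
    and init: "q 0 = Q 0" "q' 0 = V 0"
    and T: "0 \<le> T" and disc: "\<And>t. t \<in> {0..T} \<Longrightarrow> norm (Q t) \<le> 1"
  shows "{0..T} \<subseteq> J" "\<And>t. t \<in> {0..T} \<Longrightarrow> q t = Q t \<and> q' t = V t"
proof -
  have rot: "Complex (Im z) (- Re z) = - \<i> * z" for z by (simp add: complex_eq_iff)
  have J: "is_interval J" "0 \<in> J" "J \<subseteq> {0..}" "newton_on B J q q'"
    using traj by (auto simp: trajectory_def)
  have sub: "{0..t} \<subseteq> J" if "t \<in> J" for t
    using mem_is_interval_1_I[OF J(1,2) that] by auto
  have agree: "q t = Q t \<and> q' t = V t" if "t \<in> J" "t \<le> T" for t
  proof -
    have t: "t \<in> {0..t}" using that J(3) by auto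
    have der: "(q has_vector_derivative q' s) (at s within {0..t})"
      "(q' has_vector_derivative radial_ext B (q s) *\<^sub>R (- \<i> * q' s)) (at s within {0..t})"
      if "s \<in> {0..t}" for s
    proof -
      have s: "s \<in> J" using sub[OF \<open>t \<in> J\<close>] that by auto
      then have "radial_ext B (q s) = B (norm (q s))"
        using J(4) by (auto simp: newton_on_def radial_ext_def min_def)
      then have on_J: "(q has_vector_derivative q' s) (at s within J)"
        "(q' has_vector_derivative radial_ext B (q s) *\<^sub>R (- \<i> * q' s)) (at s within J)"
        using J(4) s by (simp_all add: newton_on_def rot)
      show "(q has_vector_derivative q' s) (at s within {0..t})"
        by (rule has_vector_derivative_within_subset[OF on_J(1) sub[OF \<open>t \<in> J\<close>]])
      show "(q' has_vector_derivative radial_ext B (q s) *\<^sub>R (- \<i> * q' s)) (at s within {0..t})"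
        by (rule has_vector_derivative_within_subset[OF on_J(2) sub[OF \<open>t \<in> J\<close>]])
    qed
    note unique = newton_unique[OF radial_ext_lipschitz[OF lip] der
        dQ[THEN has_vector_derivative_at_within] dV[THEN has_vector_derivative_at_within]
        speed init t]
    show ?thesis using unique by blast
  qed
  have "T \<in> J"
  proof (rule ccontr)
    assume "T \<notin> J"
    have "t < T" if "t \<in> J" for t
      using sub[OF that] T \<open>T \<notin> J\<close> by (force simp: not_less)
    then have "J \<subseteq> {0..T}" using J(3) by force
    moreover have "newton_on B {0..T} Q V"
      unfolding newton_on_def
    proof (intro ballI conjI)
      fix t assume t: "t \<in> {0..T}"
      show "Q t \<in> cball 0 1" using disc[OF t] by simp
      have "radial_ext B (Q t) = B (norm (Q t))"
        using disc[OF t] by (simp add: radial_ext_def min_def)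
      then show "(V has_vector_derivative B (norm (Q t)) *\<^sub>R Complex (Im (V t)) (- Re (V t)))
          (at t within {0..T})"
        using dV[of t] by (simp add: rot has_vector_derivative_at_within)
    qed (rule has_vector_derivative_at_within[OF dQ])
    moreover have "\<forall>t\<in>J. Q t = q t \<and> V t = q' t"
      using agree \<open>J \<subseteq> {0..T}\<close> by force
    moreover have "is_interval {0..T}" "{0..T} \<subseteq> {0..}" by (auto simp: is_interval_cc)
    ultimately have "{0..T} = J"
      using traj unfolding trajectory_def by blast
    then show False using \<open>T \<notin> J\<close> T by auto
  qed
  then show "{0..T} \<subseteq> J" by (rule sub)
  then show "q t = Q t \<and> q' t = V t" if "t \<in> {0..T}" for t
    using agree that by auto
qed

text \<open>The argument of \<open>v\<close> is \<open>\<gamma> + \<theta>\<close>, and conjugation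
  changes its sign, so the reflected velocity has the argument
  \<open>\<beta> - (\<gamma> + \<theta>)\<close>.\<close>

lemma oriented_angle_cnj:
  assumes "v \<noteq> 0" and \<gamma>: "\<gamma> = oriented_angle (cis \<theta>) v"
  shows "[oriented_angle v (cis \<beta> * cnj v) = \<beta> - 2 * \<theta> - 2 * \<gamma>] (rmod (2 * pi))"
proof -
  have v: "v / cis \<theta> = of_real (norm v) * cis \<gamma>"
  proof -
    have "cis \<gamma> = sgn (v / cis \<theta>)"
      unfolding \<gamma> oriented_angle_def using assms(1) by (intro cis_Arg) auto
    then show ?thesis using assms(1) by (simp add: sgn_div_norm norm_divide scaleR_conv_of_real)
  qed
  then have v: "v = of_real (norm v) * cis (\<gamma> + \<theta>)"
    by (simp add: field_simps flip: cis_mult)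
  have "cis (oriented_angle v (cis \<beta> * cnj v)) = sgn (cis \<beta> * cnj v / v)"
    unfolding oriented_angle_def using assms(1) by (intro cis_Arg) auto
  also have "\<dots> = cis \<beta> * cnj v / v"
    using assms(1) by (simp add: sgn_div_norm norm_divide norm_mult)
  also have "\<dots> = cis \<beta> * cis (- (\<gamma> + \<theta>)) / cis (\<gamma> + \<theta>)"
    using assms(1) by (subst (1 2) v) (simp add: cis_cnj)
  also have "\<dots> = cis (\<beta> - 2 * \<theta> - 2 * \<gamma>)"
    by (simp add: cis_mult cis_divide algebra_simps)
  finally show ?thesis unfolding cis_eq_iff .
qed

text \<open>Both cases at once: \<open>r\<close> is the turning radius, with \<open>r = 0\<close>
  for passage through the origin. Here \<open>\<alpha>\<close> is the angle swept on the way in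
  only, half of the quantity of that name in the theorem.\<close>

lemma flow_scattering:
  fixes q v :: "real \<Rightarrow> complex"
  assumes lip: "K-lipschitz_on {0..1} B"
    and dq: "\<And>t. (q has_vector_derivative v t) (at t)"
    and dv: "\<And>t. (v has_vector_derivative radial_ext B (q t) *\<^sub>R (- \<i> * v t)) (at t)"
    and speed: "\<And>t. norm (v t) = norm (v 0)"
    and init: "q 0 = cis \<theta>" "v 0 = Complex vr v\<theta> * cis \<theta>" "v 0 \<noteq> 0"
    and entering: "vr < 0 \<or> (vr = 0 \<and> B 1 / v\<theta> < -1)"
    and E: "E = (norm (v 0))\<^sup>2 / 2" and p: "p = v\<theta> + flux B 1"
    and r: "0 \<le> r" "r < 1" "r = 0 \<Longrightarrow> p = 0"
    and root: "radicand B p E (r\<^sup>2) = 0" "0 < radicand_deriv B p E (r\<^sup>2)"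
      "\<And>x. r\<^sup>2 < x \<Longrightarrow> x < 1 \<Longrightarrow> radicand B p E x \<noteq> 0"
  obtains t0 \<alpha> where "0 < t0" "\<And>t. 0 < t \<Longrightarrow> t < 2 * t0 \<Longrightarrow> norm (q t) < 1" "norm (q (2 * t0)) = 1"
    "0 < r \<Longrightarrow> \<forall>t\<in>{0..2*t0}. q t \<noteq> 0" "r = 0 \<Longrightarrow> q t0 = 0"
    "(deflection_integrand B p E has_integral \<alpha>) {r..1}"
    "v (2 * t0) = (if r = 0 then 1 else -1) * cis (2 * (\<theta> + \<alpha>)) * cnj (v 0)"
proof -
  have B: "continuous_on {0..1} B" using lip by (rule lipschitz_on_continuous_on)
  define \<rho> \<eta> where "\<rho> t = (norm (q t))\<^sup>2" and "\<eta> t = 2 * Re (cnj (q t) * v t)" for t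
  have norm_q: "norm (q t) = sqrt (\<rho> t)" for t by (simp add: \<rho>_def)
  have \<rho>0: "\<rho> 0 = 1" by (simp add: \<rho>_def init)
  have m0: "cnj (q 0) * v 0 = Complex vr v\<theta>"
    by (simp add: init cis_cnj mult.commute[of "cis (- \<theta>)"] mult.assoc cis_mult)
  have sp: "(norm (v t))\<^sup>2 = 2 * E" for t using speed[of t] by (simp add: E)
  have flux1: "flux B 1 = flux_sq B 1" using flux_eq_flux_sq[OF B, of 1] by simp
  have p': "p = Im (cnj (q 0) * v 0) + flux_sq B ((norm (q 0))\<^sup>2)"
    unfolding m0 by (simp add: init p flux1)
  note red = newton_reduced[OF B dq dv sp p', folded \<rho>_def \<eta>_def]
  have d\<rho>: "(\<rho> has_real_derivative \<eta> t) (at t)" for t using red(1)[of t] by (simp add: \<rho>_def[abs_def])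
  have d\<eta>: "(\<eta> has_real_derivative 2 * radicand_deriv B p E (\<rho> t)) (at t)" for t
    using red(2)[of t] by (simp add: \<eta>_def[abs_def])
  have \<eta>0: "\<eta> 0 = 2 * vr" unfolding \<eta>_def m0 by simp
  have E': "2 * E = vr\<^sup>2 + v\<theta>\<^sup>2"
    by (simp add: E init norm_mult cmod_power2)
  \<comment> \<open>For tangential entry the derivative is
    \<open>v\<theta>\<^sup>2 * (1 + B 1 / v\<theta>)\<close>, so the entering condition says exactly
    that the squared radius has a negative second derivative at time 0.\<close>
  have tangent: "radicand_deriv B p E 1 < 0" if "\<eta> 0 = 0"
  proof -
    have vr: "vr = 0" "B 1 / v\<theta> < -1" using that entering \<eta>0 by auto
    then have "v\<theta> \<noteq> 0" by auto
    have E2: "2 * E = v\<theta>\<^sup>2" using E' vr(1) by simp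
    have "profile_sq B 1 = B 1" using profile_sq_power2[of 1 B] by simp
    then have "radicand_deriv B p E 1 = v\<theta>\<^sup>2 * (1 + B 1 / v\<theta>)"
      using \<open>v\<theta> \<noteq> 0\<close> unfolding radicand_deriv_def E2
      by (simp add: p flux1 field_simps power2_eq_square)
    then show ?thesis using vr \<open>v\<theta> \<noteq> 0\<close> by (simp add: mult_less_0_iff)
  qed
  have r2: "0 \<le> r\<^sup>2" "r\<^sup>2 < 1" using r by (auto simp: abs_square_less_1)
  have "-1 < x" if "r\<^sup>2 \<le> x" for x using r2(1) that by linarith
  then have sub: "{r\<^sup>2..1} \<subseteq> {-1<..}" by auto
  obtain t0 where t0: "0 < t0" "\<rho> t0 = r\<^sup>2" "\<eta> t0 = 0"
    and neg: "\<And>t. 0 < t \<Longrightarrow> t < t0 \<Longrightarrow> \<eta> t < 0"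
    and inside: "\<And>t. 0 < t \<Longrightarrow> t < t0 \<Longrightarrow> r\<^sup>2 < \<rho> t \<and> \<rho> t < 1"
  proof (rule first_turning_point[OF d\<rho> d\<eta> red(4) \<rho>0 _ tangent r2(2) root(1)])
    show "\<eta> 0 \<le> 0" using entering \<eta>0 by auto
    show "0 < radicand B p E x" if "r\<^sup>2 < x" "x < 1" for x
      using radicand_pos[OF B r2(1) root] that by blast
  qed (use root in \<open>auto intro!: continuous_on_radicand B sub\<close>)
  have range: "\<rho> t \<in> {r\<^sup>2..1}" if "t \<in> {0..t0}" for t
    using that inside[of t] t0 \<rho>0 r2 by (cases "t = 0"; cases "t = t0") auto
  have q_t0: "norm (q t0) = r" using r by (simp add: norm_q t0)
  obtain w where w: "continuous_on {r\<^sup>2..1} w" "\<And>x. x \<in> {r\<^sup>2..1} \<Longrightarrow> x * w x = p - flux_sq B x"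
    using angular_velocity_extension[OF B r2(1), of p] r(3) by auto
  have cont\<rho>: "continuous_on S \<rho>" for S
    by (rule DERIV_continuous_on[OF has_field_derivative_at_within], rule d\<rho>)
  have contw: "continuous_on {0..t0} (\<lambda>t. w (\<rho> t))"
    by (rule continuous_on_compose2[OF w(1) cont\<rho>]) (use range in auto)
  define \<psi> where "\<psi> t = \<theta> + integral {0..t} (\<lambda>t. w (\<rho> t))" for t
  define \<alpha> where "\<alpha> = integral {0..t0} (\<lambda>t. w (\<rho> t))"
  have d\<psi>: "(\<psi> has_real_derivative w (\<rho> t)) (at t within {0..t0})" if "0 \<le> t" "t \<le> t0" for t
    unfolding \<psi>_def[abs_def] using integral_has_real_derivative[OF contw, of t] that
    by (auto intro!: derivative_eq_intros)
  have ang: "Im (cnj (q t) * v t) = (norm (q t))\<^sup>2 * w (\<rho> t)" if "0 \<le> t" "t \<le> t0" for t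
    using red(3)[of t] w(2)[OF range[of t]] that by (simp add: \<rho>_def)
  have nz: "q t \<noteq> 0" if "0 \<le> t" "t < t0" for t
    using inside[of t] that r2 init by (cases "t = 0") (auto simp: \<rho>_def)
  have contv: "continuous_on {0..t0} v"
    using dv by (intro continuous_on_vector_derivative) (auto intro: has_vector_derivative_at_within)
  have \<psi>0: "q 0 = cis (\<psi> 0)" and \<psi>t0: "\<psi> t0 = \<theta> + \<alpha>"
    by (simp_all add: \<psi>_def \<alpha>_def init)
  have polar: "q t0 = norm (q t0) * cis (\<psi> t0)" "Im (v t0 * cis (- \<psi> t0)) = norm (q t0) * w (\<rho> t0)"
    by (rule polar_form[where w = "\<lambda>t. w (\<rho> t)" and \<psi> = \<psi>, OF t0(1) dq contv nz ang contw d\<psi> \<psi>0];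
      assumption)+
  have polar: "q t0 = r * cis (\<theta> + \<alpha>)" "Im (v t0 * cis (- (\<theta> + \<alpha>))) = r * w (\<rho> t0)"
    using polar unfolding q_t0 \<psi>t0 by simp_all
  define y where "y = v t0 * cis (- (\<theta> + \<alpha>))"
  have v_t0: "v t0 = y * cis (\<theta> + \<alpha>)"
    by (simp add: y_def mult.assoc cis_mult)
  \<comment> \<open>Multiplying the conjugate by \<open>cis (2 * \<phi>)\<close> reflects in the
    line of direction \<open>cis \<phi>\<close>. For \<open>r > 0\<close> the axis passes through
    \<open>q t0\<close>. At the origin the velocity itself points along
    \<open>cis (\<theta> + \<alpha>)\<close>, so the axis has to be perpendicular, which is the sign
    -1.\<close>
  define c where "c = (if r = 0 then -1 else 1) * cis (2 * (\<theta> + \<alpha>))"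
  have cis2: "cis (2 * (\<theta> + \<alpha>)) * cis (- (\<theta> + \<alpha>)) = cis (\<theta> + \<alpha>)"
    unfolding cis_mult by simp
  have c: "norm c = 1" "c * cnj (q t0) = q t0" "c * cnj (v t0) = - v t0"
  proof -
    show "norm c = 1" by (simp add: c_def)
    show "c * cnj (q t0) = q t0"
      using cis2 unfolding polar(1) by (simp add: c_def cis_cnj mult_ac)
    \<comment> \<open>For \<open>r > 0\<close> the velocity is tangential at \<open>t0\<close>,
      since the radial part is proportional to \<open>\<eta> t0 = 0\<close>; for
      \<open>r = 0\<close> it is parallel to the limiting direction.\<close>
    have "cnj y = (if r = 0 then y else - y)"
    proof (cases "r = 0")
      case True
      then have "Im y = 0" using polar(2) by (simp add: y_def)
      with True show ?thesis by (simp add: complex_eq_iff)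
    next
      case False
      have "cnj (q t0) * v t0 = of_real r * y"
        unfolding polar(1) by (simp add: y_def cis_cnj mult_ac)
      then have "r * Re y = 0" using t0(3) by (simp add: \<eta>_def del: complex_cnj_mult)
      with False show ?thesis by (simp add: complex_eq_iff)
    qed
    then show "c * cnj (v t0) = - v t0"
      using cis2 unfolding v_t0 by (simp add: c_def cis_cnj mult_ac)
  qed
  have radial: "radial_ext B z = radial_ext B z'" if "norm z = norm z'" for z z'
    using that by (simp add: radial_ext_def)
  note refl = newton_reflection[OF radial_ext_lipschitz[OF lip] radial dq dv eq_refl[OF speed] c]
  have q_refl: "norm (q t) = norm (q (2 * t0 - t))" if "t0 \<le> t" for t
    using refl(1)[of "t - t0"] that c(1) by (simp add: norm_mult)
  have inside_left: "norm (q t) < 1" if "0 < t" "t \<le> t0" for t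
    using inside[of t] that r(2) q_t0 by (cases "t = t0") (auto simp: norm_q)
  show ?thesis
  proof (rule that[OF t0(1)])
    show "norm (q t) < 1" if "0 < t" "t < 2 * t0" for t
    proof (cases "t \<le> t0")
      case False
      have "norm (q (2 * t0 - t)) < 1" by (rule inside_left) (use False that in auto)
      then show ?thesis unfolding q_refl[OF less_imp_le[OF False[unfolded not_le]]] .
    qed (use inside_left that in simp)
    show "norm (q (2 * t0)) = 1" using q_refl[of "2 * t0"] t0(1) by (simp add: init)
    show "\<forall>t\<in>{0..2*t0}. q t \<noteq> 0" if "0 < r"
    proof
      fix t assume t: "t \<in> {0..2*t0}"
      have left: "norm (q s) \<noteq> 0" if "0 \<le> s" "s \<le> t0" for s
        using nz[of s] q_t0 \<open>0 < r\<close> that by (cases "s = t0") auto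
      have "norm (q t) \<noteq> 0"
      proof (cases "t \<le> t0")
        case False
        have "norm (q (2 * t0 - t)) \<noteq> 0" by (rule left) (use False t in auto)
        then show ?thesis unfolding q_refl[OF less_imp_le[OF False[unfolded not_le]]] .
      qed (use left t in simp)
      then show "q t \<noteq> 0" by simp
    qed
    show "q t0 = 0" if "r = 0" using q_t0 that by simp
    show "v (2 * t0) = (if r = 0 then 1 else -1) * cis (2 * (\<theta> + \<alpha>)) * cnj (v 0)"
      using refl(2)[of t0] t0(1) by (simp add: c_def)
    \<comment> \<open>The radius decreases on the way in, so integration over increasing radius runs
      backwards in time; this is why the primitive is minus the angle.\<close>
    have "(deflection_integrand B p E has_integral (\<theta> - \<psi> 0) - (\<theta> - \<psi> t0)) {norm (q t0)..norm (q 0)}"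
    proof (rule has_integral_substitution_decreasing[where g' = "\<lambda>t. \<eta> t / (2 * norm (q t))", OF t0(1)])
      show "continuous_on {0..t0} (\<lambda>t. norm (q t))"
        unfolding norm_q by (intro continuous_intros cont\<rho>)
      have cont\<psi>: "continuous_on {0..t0} \<psi>"
        using d\<psi> by (intro DERIV_continuous_on) auto
      then show "continuous_on {0..t0} (\<lambda>t. \<theta> - \<psi> t)" by (intro continuous_intros)
      fix t assume t: "0 < t" "t < t0"
      have pos: "0 < \<rho> t" using inside[OF t] r2 by linarith
      show "((\<lambda>t. norm (q t)) has_real_derivative \<eta> t / (2 * norm (q t))) (at t)"
        unfolding norm_q using d\<rho>[of t] pos
        by (auto intro!: derivative_eq_intros simp: field_simps)
      show "\<eta> t / (2 * norm (q t)) < 0"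
        using neg[OF t] pos by (simp add: norm_q divide_neg_pos)
      have n: "0 < norm (q t)" "norm (q t) \<le> 1" "(norm (q t))\<^sup>2 = \<rho> t"
        using pos inside[OF t] by (auto simp: norm_q)
      have flux: "flux B (norm (q t)) = flux_sq B (\<rho> t)"
        using flux_eq_flux_sq[OF B, of "norm (q t)"] n by simp
      have "radicand B p E (\<rho> t) = (- \<eta> t / 2)\<^sup>2"
        using red(4)[of t] by (simp add: power_divide)
      \<comment> \<open>The negative sign is that of inward motion. The factor
        \<open>\<eta> t\<close> then cancels between the integrand and the derivative of the
        radius.\<close>
      then have "sqrt (radicand B p E (\<rho> t)) = - \<eta> t / 2"
        using neg[OF t] by (simp add: real_sqrt_abs)
      then have "deflection_integrand B p E (norm (q t)) = \<rho> t * w (\<rho> t) / (norm (q t) * (- \<eta> t / 2))"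
        using w(2)[OF range[of t]] t
        unfolding deflection_integrand_def flux n(3) radicand_def by simp
      moreover have "n\<^sup>2 * x / (n * (- h / 2)) * (h / (2 * n)) = - x" if "n \<noteq> 0" "h \<noteq> 0" for n h x :: real
        using that by (simp add: power2_eq_square)
      ultimately have eq: "deflection_integrand B p E (norm (q t)) * (\<eta> t / (2 * norm (q t))) = - w (\<rho> t)"
        using neg[OF t] n(1) by (simp only: n(3)[symmetric])
      have "at t within {0..t0} = at t" using t by (intro at_within_interior) auto
      then have "(\<psi> has_real_derivative w (\<rho> t)) (at t)"
        using d\<psi>[of t] t by simp
      then show "((\<lambda>t. \<theta> - \<psi> t) has_real_derivative
          deflection_integrand B p E (norm (q t)) * (\<eta> t / (2 * norm (q t)))) (at t)"
        unfolding eq by (auto intro!: derivative_eq_intros)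
    qed
    then show "(deflection_integrand B p E has_integral \<alpha>) {r..1}"
      by (simp add: q_t0 init \<psi>_def \<alpha>_def)
  qed
qed

theorem theorem2p5:
  fixes B :: "real \<Rightarrow> real" and J :: "real set" and q q' :: "real \<Rightarrow> complex"
    and v1 :: complex and \<theta> v\<^sub>r v\<^sub>\<theta> \<gamma> H\<^sub>0 p\<^sub>\<theta> r_star :: real
  assumes field: "extends_locally_lipschitz B"
    and traj: "trajectory B J q q'"
    and start: "q 0 = cis \<theta>" "q' 0 = v1"
    and velocity: "v1 = Complex v\<^sub>r v\<^sub>\<theta> * cis \<theta>" "v1 \<noteq> 0"
    and entering: "v\<^sub>r < 0 \<or> (v\<^sub>r = 0 \<and> B 1 / v\<^sub>\<theta> < -1)"
    and \<gamma>: "\<gamma> = oriented_angle (cis \<theta>) v1"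
    and H\<^sub>0: "H\<^sub>0 = (norm v1)\<^sup>2 / 2"
    and p\<^sub>\<theta>: "p\<^sub>\<theta> = v\<^sub>\<theta> + flux B 1"
    and cases:
      "(is_arg_min (\<lambda>r. dist r 1) (\<lambda>r. r \<in> {0<..<1} \<and> eff_potential B p\<^sub>\<theta> r = H\<^sub>0) r_star
          \<and> deriv (eff_potential B p\<^sub>\<theta>) r_star < 0)
       \<or> (p\<^sub>\<theta> = 0 \<and> \<not> (\<exists>r\<in>{0<..<1}. eff_potential B p\<^sub>\<theta> r = H\<^sub>0))"
  shows "\<exists>T v2. escapes_at J q q' T v2 \<and> norm v2 = norm v1 \<and>
    ((is_arg_min (\<lambda>r. dist r 1) (\<lambda>r. r \<in> {0<..<1} \<and> eff_potential B p\<^sub>\<theta> r = H\<^sub>0) r_star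
        \<and> deriv (eff_potential B p\<^sub>\<theta>) r_star < 0
        \<and> (\<forall>t\<in>{0..T}. q t \<noteq> 0)
        \<and> deflection_integrand B p\<^sub>\<theta> H\<^sub>0 integrable_on {r_star..1}
        \<and> (let \<alpha> = 2 * integral {r_star..1} (deflection_integrand B p\<^sub>\<theta> H\<^sub>0)
            in [oriented_angle v1 v2 = \<alpha> + pi - 2 * \<gamma>] (rmod (2 * pi))))
     \<or> (p\<^sub>\<theta> = 0 \<and> \<not> (\<exists>r\<in>{0<..<1}. eff_potential B p\<^sub>\<theta> r = H\<^sub>0)
        \<and> (\<exists>t\<in>{0..T}. q t = 0)
        \<and> deflection_integrand B 0 H\<^sub>0 integrable_on {0..1}
        \<and> (let \<alpha> = 2 * integral {0..1} (deflection_integrand B 0 H\<^sub>0)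
            in [oriented_angle v1 v2 = \<alpha> - 2 * \<gamma>] (rmod (2 * pi)))))"
proof -
  obtain K where lip: "K-lipschitz_on {0..1} B" using field by (rule extends_lipschitz_on)
  have B: "continuous_on {0..1} B" using lip by (rule lipschitz_on_continuous_on)
  let ?nearest = "is_arg_min (\<lambda>r. dist r 1) (\<lambda>r. r \<in> {0<..<1} \<and> eff_potential B p\<^sub>\<theta> r = H\<^sub>0) r_star"
  let ?slope = "deriv (eff_potential B p\<^sub>\<theta>) r_star < 0"
  let ?turning = "?nearest \<and> ?slope"
  let ?central = "p\<^sub>\<theta> = 0 \<and> \<not> (\<exists>r\<in>{0<..<1}. eff_potential B p\<^sub>\<theta> r = H\<^sub>0)"
  have H\<^sub>0_pos: "0 < H\<^sub>0" unfolding H\<^sub>0 using velocity(2) by simp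
  \<comment> \<open>The value 0 encodes the central case and lets both cases be treated by
    \<open>flow_scattering\<close>.\<close>
  define r where "r = (if ?turning then r_star else 0)"
  have potential: "radicand B p\<^sub>\<theta> H\<^sub>0 x \<noteq> 0"
    if "eff_potential B p\<^sub>\<theta> (sqrt x) \<noteq> H\<^sub>0" "0 < x" "x < 1" for x
    using eff_potential_eq_iff[OF B, of "sqrt x" p\<^sub>\<theta> H\<^sub>0] that by simp
  have r: "0 \<le> r" "r < 1" "r = 0 \<Longrightarrow> p\<^sub>\<theta> = 0" "0 < r \<longleftrightarrow> ?turning"
    and root: "radicand B p\<^sub>\<theta> H\<^sub>0 (r\<^sup>2) = 0" "0 < radicand_deriv B p\<^sub>\<theta> H\<^sub>0 (r\<^sup>2)"
      "\<And>x. r\<^sup>2 < x \<Longrightarrow> x < 1 \<Longrightarrow> radicand B p\<^sub>\<theta> H\<^sub>0 x \<noteq> 0"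
  proof -
    have "0 \<le> r \<and> r < 1 \<and> (r = 0 \<longrightarrow> p\<^sub>\<theta> = 0) \<and> (0 < r \<longleftrightarrow> ?turning)
      \<and> radicand B p\<^sub>\<theta> H\<^sub>0 (r\<^sup>2) = 0 \<and> 0 < radicand_deriv B p\<^sub>\<theta> H\<^sub>0 (r\<^sup>2)
      \<and> (\<forall>x. r\<^sup>2 < x \<longrightarrow> x < 1 \<longrightarrow> radicand B p\<^sub>\<theta> H\<^sub>0 x \<noteq> 0)"
    proof (cases ?turning)
      case True
      then have rs: "r = r_star" "0 < r" "r < 1" "eff_potential B p\<^sub>\<theta> r = H\<^sub>0"
        "deriv (eff_potential B p\<^sub>\<theta>) r < 0"
        and closest: "\<And>s. 0 < s \<Longrightarrow> s < 1 \<Longrightarrow> eff_potential B p\<^sub>\<theta> s = H\<^sub>0 \<Longrightarrow> \<not> dist s 1 < dist r 1"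
        by (auto simp: r_def is_arg_min_def)
      have 0: "radicand B p\<^sub>\<theta> H\<^sub>0 (r\<^sup>2) = 0" using eff_potential_eq_iff[OF B] rs by simp
      have 1: "0 < radicand_deriv B p\<^sub>\<theta> H\<^sub>0 (r\<^sup>2)"
        using deriv_eff_potential[OF B rs(2,3) 0] rs by (simp add: zero_less_divide_iff)
      have "radicand B p\<^sub>\<theta> H\<^sub>0 x \<noteq> 0" if x: "r\<^sup>2 < x" "x < 1" for x
      proof (rule potential)
        show pos: "0 < x" using x(1) zero_le_power2[of r] by linarith
        \<comment> \<open>A solution of the potential equation between \<open>r\<close> and 1 would
          be closer to 1 than \<open>r_star\<close>.\<close>
        have "r < sqrt x" using x(1) by (simp add: real_less_rsqrt)
        moreover have "sqrt x < 1" using x(2) by simp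
        ultimately show "eff_potential B p\<^sub>\<theta> (sqrt x) \<noteq> H\<^sub>0"
          using closest[of "sqrt x"] pos rs by (auto simp: dist_real_def)
      qed (rule x(2))
      with 0 1 rs True show ?thesis by auto
    next
      case False
      then have "r = 0" "p\<^sub>\<theta> = 0" and none: "\<And>s. 0 < s \<Longrightarrow> s < 1 \<Longrightarrow> eff_potential B p\<^sub>\<theta> s \<noteq> H\<^sub>0"
        using cases by (auto simp: r_def)
      have "radicand B p\<^sub>\<theta> H\<^sub>0 x \<noteq> 0" if "0 < x" "x < 1" for x
        using potential[of x] none[of "sqrt x"] that by simp
      \<comment> \<open>With \<open>p\<^sub>\<theta> = 0\<close> the radicand vanishes at 0 with
        derivative \<open>2 * H\<^sub>0\<close>, so this zero is simple because the energy is
        positive.\<close>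
      with False \<open>r = 0\<close> \<open>p\<^sub>\<theta> = 0\<close> H\<^sub>0_pos show ?thesis
        by (simp add: radicand_def radicand_deriv_def)
    qed
    then show "0 \<le> r" "r < 1" "r = 0 \<Longrightarrow> p\<^sub>\<theta> = 0" "0 < r \<longleftrightarrow> ?turning"
      "radicand B p\<^sub>\<theta> H\<^sub>0 (r\<^sup>2) = 0" "0 < radicand_deriv B p\<^sub>\<theta> H\<^sub>0 (r\<^sup>2)"
      "\<And>x. r\<^sup>2 < x \<Longrightarrow> x < 1 \<Longrightarrow> radicand B p\<^sub>\<theta> H\<^sub>0 x \<noteq> 0"
      by blast+
  qed
  obtain Q V where QV: "Q 0 = cis \<theta>" "V 0 = v1" "\<And>t. norm (V t) = norm v1"
    and dQ: "\<And>t. (Q has_vector_derivative V t) (at t)"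
    and dV: "\<And>t. (V has_vector_derivative radial_ext B (Q t) *\<^sub>R (- \<i> * V t)) (at t)"
    using newton_flow[OF radial_ext_lipschitz[OF lip] radial_ext_bounded[OF lip],
        where ?q0.0 = "cis \<theta>" and ?v0.0 = v1] by blast
  have speed: "norm (V t) = norm (V 0)" for t using QV by simp
  obtain t0 \<beta> where t0: "0 < t0" "\<And>t. 0 < t \<Longrightarrow> t < 2 * t0 \<Longrightarrow> norm (Q t) < 1" "norm (Q (2 * t0)) = 1"
    and origin: "0 < r \<Longrightarrow> \<forall>t\<in>{0..2*t0}. Q t \<noteq> 0" "r = 0 \<Longrightarrow> Q t0 = 0"
    and integral: "(deflection_integrand B p\<^sub>\<theta> H\<^sub>0 has_integral \<beta>) {r..1}"
    and v2: "V (2 * t0) = (if r = 0 then 1 else -1) * cis (2 * (\<theta> + \<beta>)) * cnj (V 0)"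
    by (rule flow_scattering[OF lip dQ dV speed QV(1) _ _ entering _ p\<^sub>\<theta> r(1,2,3) root])
      (use QV velocity H\<^sub>0 in auto)
  \<comment> \<open>By the symmetry about \<open>t0\<close> the way out takes as long as the way
    in.\<close>
  define T where "T = 2 * t0"
  have T: "0 < T" using t0(1) by (simp add: T_def)
  have "norm (Q t) \<le> 1" if "t \<in> {0..T}" for t
    using that t0(2)[of t] t0(3) QV(1) by (cases "t = 0 \<or> t = T") (auto simp: T_def less_le)
  note follow = trajectory_follows_flow[OF lip traj dQ dV eq_refl[OF QV(3)] _ _ less_imp_le[OF T] this]
  have J: "{0..T} \<subseteq> J" and eq: "\<And>t. t \<in> {0..T} \<Longrightarrow> q t = Q t \<and> q' t = V t"
    using follow start QV by auto
  have escape: "escapes_at J q q' T (V T)"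
    unfolding escapes_at_def using J T eq t0(2,3) by (auto simp: T_def)
  have angle: "[oriented_angle v1 (cis \<phi> * cnj v1) = \<phi> - 2 * \<theta> - 2 * \<gamma>] (rmod (2 * pi))" for \<phi>
    using velocity(2) \<gamma> by (rule oriented_angle_cnj)
  show ?thesis
  proof (intro exI conjI)
    show "escapes_at J q q' T (V T)" by (rule escape)
    show "norm (V T) = norm v1" by (rule QV)
    show "(?nearest \<and> ?slope \<and> (\<forall>t\<in>{0..T}. q t \<noteq> 0)
        \<and> deflection_integrand B p\<^sub>\<theta> H\<^sub>0 integrable_on {r_star..1}
        \<and> (let \<alpha> = 2 * integral {r_star..1} (deflection_integrand B p\<^sub>\<theta> H\<^sub>0)
            in [oriented_angle v1 (V T) = \<alpha> + pi - 2 * \<gamma>] (rmod (2 * pi))))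
     \<or> (p\<^sub>\<theta> = 0 \<and> \<not> (\<exists>r\<in>{0<..<1}. eff_potential B p\<^sub>\<theta> r = H\<^sub>0)
        \<and> (\<exists>t\<in>{0..T}. q t = 0)
        \<and> deflection_integrand B 0 H\<^sub>0 integrable_on {0..1}
        \<and> (let \<alpha> = 2 * integral {0..1} (deflection_integrand B 0 H\<^sub>0)
            in [oriented_angle v1 (V T) = \<alpha> - 2 * \<gamma>] (rmod (2 * pi))))"
    proof (cases "?turning")
      case True
      then have "0 < r" "r = r_star" using r(4) by (auto simp: r_def)
      \<comment> \<open>The factor -1 of the reflected velocity is absorbed as a half turn and
        becomes the summand \<open>pi\<close> of the scattering angle.\<close>
      have "V T = cis (2 * (\<theta> + \<beta>) + pi) * cnj v1"
        using v2 \<open>0 < r\<close> by (simp add: T_def QV minus_cis[symmetric])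
      then have "[oriented_angle v1 (V T) = 2 * \<beta> + pi - 2 * \<gamma>] (rmod (2 * pi))"
        using angle[of "2 * (\<theta> + \<beta>) + pi"] by (simp add: algebra_simps)
      moreover have "\<forall>t\<in>{0..T}. q t \<noteq> 0"
        using origin(1)[OF \<open>0 < r\<close>] eq by (simp add: T_def)
      ultimately show ?thesis
        using True integral unfolding \<open>r = r_star\<close> by (auto simp: Let_def integral_unique)
    next
      case False
      then have "r = 0" ?central using cases by (auto simp: r_def)
      have "V T = cis (2 * (\<theta> + \<beta>)) * cnj v1"
        using v2 \<open>r = 0\<close> by (simp add: T_def QV)
      then have "[oriented_angle v1 (V T) = 2 * \<beta> - 2 * \<gamma>] (rmod (2 * pi))"
        using angle[of "2 * (\<theta> + \<beta>)"] by (simp add: algebra_simps)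
      moreover have "\<exists>t\<in>{0..T}. q t = 0"
        using origin(2)[OF \<open>r = 0\<close>] eq[of t0] t0(1) by (intro bexI[of _ t0]) (auto simp: T_def)
      ultimately show ?thesis
        using \<open>?central\<close> integral unfolding \<open>r = 0\<close> by (auto simp: Let_def integral_unique)
    qed
  qed
qed

end
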